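(* Let $L:\mathbb{C}\to\mathbb{C}$ be a nonconstant entire function and let $f$ be a nonconstant meromorphic function on $\mathbb{C}$. Then $f$ is a solution of $$f^3(z)+f^3(L(z))=1$$ if and only if $L(z)=qz+c$ is a linear function (with constants $q,c$) with $|q|=1$, and $$f(z)=\frac{\frac12\left\{1+\frac{\wp'(h(z))}{\sqrt3}\right\}}{\wp(h(z))},$$ where $h$ is a nonconstant entire function satisfying one of the following equations: (1) $h(L(z))=Ah(z)+\theta_1+\tau_1$ with some $\tau_1\in\mathbb{L}$; (2) $h(L(z))=Ah(z)+\theta_2+\tau_2$ with some $\tau_2\in\mathbb{L}$; (3) $h(L(z))=Ah(z)+\tau_3$ with some $\tau_3\in\mathbb{L}$; where $A$ is a constant with $A^3=-1$ and $A\tau\in\mathbb{L}$ for every period $\tau$ of $\wp$.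
   Context: Meromorphic and entire functions are on the whole complex plane $\mathbb{C}$, and $f^3(z)$ means $(f(z))^3$. $\wp$ denotes the Weierstrass elliptic function $$\wp(z)=\frac1{z^2}+\sum_{\mu,\nu\in\mathbb{Z};\,\mu^2+\nu^2\neq0}\left\{\frac1{(z+\mu\omega_1+\nu\omega_2)^2}-\frac1{(\mu\omega_1+\nu\omega_2)^2}\right\}$$ with periods $\omega_1,\omega_2$ ($\operatorname{Im}(\omega_1/\omega_2)\neq0$) chosen so that $(\wp')^2=4\wp^3-1$. Its period lattice is $\mathbb{L}=\{\mu\omega_1+\nu\omega_2:\mu,\nu\in\mathbb{Z}\}$. In the period parallelogram $D$ with vertices $0,\omega_1,\omega_2,\omega_1+\omega_2$, $\wp$ has exactly two distinct zeros $\theta_1,\theta_2$, labelled so that $\wp'(\theta_1)=-i$ and $\wp'(\theta_2)=i$. *)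

theory Defs
  imports "HOL-Complex_Analysis.Complex_Analysis"
begin

definition period_lattice :: "complex \<Rightarrow> complex \<Rightarrow> complex set" where
  "period_lattice \<omega>\<^sub>1 \<omega>\<^sub>2 =
     {of_int \<mu> * \<omega>\<^sub>1 + of_int \<nu> * \<omega>\<^sub>2 | \<mu> \<nu> :: int. True}"

(* Half-open, so that it contains exactly one representative of each class modulo the lattice.
   (In the closed parallelogram the zeros of \<wp> may occur repeatedly, on opposite sides.) *)
definition period_parallelogram :: "complex \<Rightarrow> complex \<Rightarrow> complex set" where
  "period_parallelogram \<omega>\<^sub>1 \<omega>\<^sub>2 =
     {of_real s * \<omega>\<^sub>1 + of_real t * \<omega>\<^sub>2 | s t :: real. 0 \<le> s \<and> s < 1 \<and> 0 \<le> t \<and> t < 1}"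

(* The sum converges absolutely for every z if the periods are independent over the reals. At the lattice points, which are the poles of \<wp>,
   division by zero makes the value meaningless (for example the value at 0 is 0), so pointwise
   statements about this function and its derivative have to exclude them. *)
definition weierstrass_p :: "complex \<Rightarrow> complex \<Rightarrow> complex \<Rightarrow> complex" where
  "weierstrass_p \<omega>\<^sub>1 \<omega>\<^sub>2 z =
     1 / z\<^sup>2 +
     (\<Sum>\<^sub>\<infinity>(\<mu>, \<nu>) \<in> {(\<mu> :: int, \<nu> :: int). \<mu>\<^sup>2 + \<nu>\<^sup>2 \<noteq> 0}.
        1 / (z + of_int \<mu> * \<omega>\<^sub>1 + of_int \<nu> * \<omega>\<^sub>2)\<^sup>2 -
        1 / (of_int \<mu> * \<omega>\<^sub>1 + of_int \<nu> * \<omega>\<^sub>2)\<^sup>2)"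

(* Equality in the field of meromorphic functions on the plane: meromorphic_on leaves the values
   at the points of a discrete closed set (in particular at poles) unspecified, so meromorphic
   functions are compared off such a set. *)
definition mero_eq :: "(complex \<Rightarrow> complex) \<Rightarrow> (complex \<Rightarrow> complex) \<Rightarrow> bool" where
  "mero_eq f g \<longleftrightarrow> (\<forall>\<^sub>\<approx>z\<in>UNIV. f z = g z)"

end

theory Submission
  imports Defs
begin

text \<open>
  The functions F = (1 + P'/sqrt 3) / (2 P) (fermat_x) and G = (1 - P'/sqrt 3) / (2 P) (fermat_y)
  satisfy F^3 + G^3 = 1, so they parametrise the Fermat cubic by the torus of the lattice, with
  F' = sqrt 3 G^2 and G(w) = F(-w). The proof rests on four facts.

  Lifting (fermat_lift). If f^3 + g^3 = 1 for meromorphic f and g, then f = F(h) and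
  g = \<eta> G(h) for an entire h and a cube root of unity \<eta>. Locally h is an inverse branch of F
  applied to f, and then h' is a constant times f'/g^2. This is the pull-back of the
  holomorphic differential of the cubic, and it is entire: at points where g vanishes it equals
  - g'/f^2, and at common poles of f and g it is bounded. So h extends as a primitive.

  Rigidity (fermat_x_semiconj). If F(u) = \<eta> F(v) for entire u and v, then G(u)/G(v) has cube 1 and
  is therefore constant, so u' is a constant multiple of v' and u = B v + c with B^3 = 1.
  Comparing poles of F(B w + c) and F(w) confines c to the classes of 0, \<theta>1 and \<theta>2. For
  g = f(L) the lift gives F(h(L)) = \<eta> F(-h), and hence h(L) = A h + t of the required shape.

  Growth (semiconjugate_to_isometry_imp_linear). An identity h(L) = A h + t with |A| = 1 says that
  composition with L changes |h| by at most a constant. By Schottky's theorem, for nonlinear L and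
  large r the image of the disc of radius r contains a circle of radius at least 2 r, so the
  maximum of |h| would grow only by a constant when r doubles. This contradicts Liouville's
  theorem. The same comparison excludes L(z) = q z + c with |q| different from 1.

  Symmetry (wp_rotation, fermat_x_cube_translate). The converse and the comparison of poles need the
  rotations by cube roots of unity and the translations by \<theta>1 and \<theta>2. They all come from one
  uniqueness principle, ode_unique: an equation u'^n = R(u) has at most one solution with
  given value and given nonzero slope. It is applied to P itself at its zeros, where the equation
  P'^2 = 4 P^3 - 1 gives P' = \<i> or P' = -\<i>, and to 1/F at \<theta>1 and \<theta>2.
\<close>

section \<open>Meromorphic functions on the plane\<close>

text \<open>Equality of meromorphic functions is tested off a sparse set; the identity theorem reduces it
  to equality near a single point.\<close>

lemma mero_eq_identity:
  assumes "f meromorphic_on UNIV" "g meromorphic_on UNIV" "\<forall>\<^sub>F z in nhds a. f z = g z"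
  shows "mero_eq f g"
proof -
  have "(\<lambda>z. f z - g z) meromorphic_on UNIV"
    by (intro meromorphic_intros assms)
  then have "(\<forall>\<^sub>\<approx>z\<in>UNIV. f z - g z = 0) \<or> (\<forall>\<^sub>\<approx>z\<in>UNIV. f z - g z \<noteq> 0)"
    by (rule meromorphic_imp_constant_or_avoid) auto
  moreover have "\<not> (\<forall>\<^sub>\<approx>z\<in>UNIV. f z - g z \<noteq> 0)"
  proof
    assume "\<forall>\<^sub>\<approx>z\<in>UNIV. f z - g z \<noteq> 0"
    then have "\<forall>\<^sub>F z in at a. f z - g z \<noteq> 0" using eventually_cosparse_imp_eventually_at by blast
    moreover have "\<forall>\<^sub>F z in at a. f z = g z"
      using assms(3) by (auto simp: eventually_at_filter elim: eventually_mono)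
    ultimately have "\<forall>\<^sub>F z in at a. False" by eventually_elim simp
    then show False by simp
  qed
  ultimately show ?thesis by (simp add: mero_eq_def)
qed

lemma entire_tendsto:
  fixes h :: "complex \<Rightarrow> complex"
  assumes "h holomorphic_on UNIV"
  shows "h \<midarrow>z\<rightarrow> h z"
proof -
  have "isCont h z"
    using holomorphic_on_imp_continuous_on[OF assms] continuous_on_eq_continuous_at by blast
  then show ?thesis by (rule isContD)
qed

lemma analytic_tendsto_nhds:
  assumes "f analytic_on {z}"
  shows "filterlim f (nhds (f z)) (nhds z)"
proof -
  have "f \<midarrow>z\<rightarrow> f z" using analytic_at_imp_isCont[OF assms] by (rule isContD)
  then show ?thesis using tendsto_nhds_iff[of f "f z" z] by blast
qed

lemma analytic_eventually_analytic:
  assumes "f analytic_on {z}"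
  shows "\<forall>\<^sub>F w in nhds z. f analytic_on {w}"
proof -
  obtain S where S: "open S" "z \<in> S" "f holomorphic_on S"
    using assms by (auto simp: analytic_at)
  have "\<forall>\<^sub>F w in nhds z. w \<in> S" using S by (intro eventually_nhds_in_open)
  then show ?thesis by eventually_elim (use S in \<open>auto simp: analytic_at\<close>)
qed

lemma cosparse_eventually_nhds:
  assumes "\<forall>\<^sub>\<approx>z\<in>UNIV. Q z"
  shows "\<forall>\<^sub>\<approx>z\<in>(UNIV::complex set). \<forall>\<^sub>F w in nhds z. Q w"
proof (rule eventually_mono[OF assms])
  let ?X = "{z. \<not> Q z}"
  have "closed ?X"
    using assms sparse_in_UNIV_imp_closed unfolding eventually_cosparse by blast
  then have op: "open (- ?X)" by (simp add: open_Compl)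
  fix z assume "Q z"
  then have "\<forall>\<^sub>F w in nhds z. w \<in> - ?X" by (intro eventually_nhds_in_open op) auto
  then show "\<forall>\<^sub>F w in nhds z. Q w" by simp
qed

text \<open>A nonconstant entire map takes no value on a set with an accumulation point, so it pulls
  sparse sets back to sparse sets. This is what makes substitution into identities
  between meromorphic functions legitimate.\<close>

lemma cosparse_compose_entire:
  assumes h: "h holomorphic_on UNIV" "\<not> h constant_on UNIV"
    and Q: "\<forall>\<^sub>\<approx>w\<in>UNIV. Q w"
  shows "\<forall>\<^sub>\<approx>z\<in>UNIV. Q (h z)"
proof -
  have "eventually (\<lambda>z. Q (h z)) (at z)" for z
  proof -
    have 1: "\<forall>\<^sub>F w in at (h z). Q w"
      using Q eventually_cosparse_imp_eventually_at by blast
    have hm: "h meromorphic_on UNIV"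
      by (simp add: analytic_on_imp_meromorphic_on analytic_on_open h(1))
    have "(\<forall>\<^sub>\<approx>x\<in>UNIV. h x = h z) \<or> (\<forall>\<^sub>\<approx>x\<in>UNIV. h x \<noteq> h z)"
      by (rule meromorphic_imp_constant_or_avoid[OF hm]) auto
    moreover have "\<not> (\<forall>\<^sub>\<approx>x\<in>UNIV. h x = h z)"
    proof
      assume *: "\<forall>\<^sub>\<approx>x\<in>UNIV. h x = h z"
      have "h x = h z" for x
      proof -
        have "\<forall>\<^sub>F x in at x. h x = h z"
          using * eventually_cosparse_imp_eventually_at by blast
        then have "h \<midarrow>x\<rightarrow> h z"
          by (simp add: tendsto_eventually)
        moreover have "h \<midarrow>x\<rightarrow> h x"
          by (rule entire_tendsto[OF h(1)])
        ultimately show ?thesis using tendsto_unique[of "at x" h "h x" "h z"] by simp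
      qed
      then show False using h(2) by (auto simp: constant_on_def)
    qed
    ultimately have "\<forall>\<^sub>F x in at z. h x \<noteq> h z"
      using eventually_cosparse_imp_eventually_at by blast
    moreover have "h \<midarrow>z\<rightarrow> h z"
      by (rule entire_tendsto[OF h(1)])
    ultimately have "filterlim h (at (h z)) (at z)"
      by (simp add: filterlim_at)
    with 1 show ?thesis by (auto simp: filterlim_iff)
  qed
  then show ?thesis by (simp add: eventually_cosparse_open_eq)
qed

lemma affine_entire:
  assumes "a \<noteq> (0::complex)"
  shows "(\<lambda>z. a * z + b) holomorphic_on UNIV" "\<not> (\<lambda>z. a * z + b) constant_on UNIV"
proof -
  show "\<not> (\<lambda>z. a * z + b) constant_on UNIV"
  proof
    assume "(\<lambda>z. a * z + b) constant_on UNIV"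
    then obtain y where y: "\<And>z. a * z + b = y" by (auto simp: constant_on_def)
    from y[of 0] y[of 1] show False using assms by simp
  qed
qed (intro holomorphic_intros)

lemma cosparse_affine:
  assumes "\<forall>\<^sub>\<approx>w\<in>UNIV. Q w" "a \<noteq> (0::complex)"
  shows "\<forall>\<^sub>\<approx>z\<in>UNIV. Q (a * z + b)"
  using cosparse_compose_entire[OF affine_entire[OF assms(2)] assms(1)] .

lemma cosparse_const_iff [simp]: "(\<forall>\<^sub>\<approx>z\<in>(UNIV::complex set). Q) \<longleftrightarrow> Q"
  by (cases Q) auto

lemma mero_compose_entire:
  assumes "f meromorphic_on UNIV" "h holomorphic_on UNIV"
  shows "(\<lambda>z. f (h z)) meromorphic_on UNIV"
proof -
  have "h analytic_on UNIV" using assms(2) by (simp add: analytic_on_open)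
  from meromorphic_on_compose[OF assms(1) this] show ?thesis by simp
qed

lemma mero_eq_if_compose_eq:
  assumes "f meromorphic_on UNIV" "g meromorphic_on UNIV"
    and v: "v holomorphic_on UNIV" "\<not> v constant_on UNIV"
    and eq: "\<forall>\<^sub>\<approx>z\<in>UNIV. f (v z) = g (v z)"
  shows "\<forall>\<^sub>\<approx>w\<in>UNIV. f w = g w"
proof -
  have "(\<lambda>z. f z - g z) meromorphic_on UNIV" by (intro meromorphic_intros assms)
  then have "(\<forall>\<^sub>\<approx>z\<in>UNIV. f z - g z = 0) \<or> (\<forall>\<^sub>\<approx>z\<in>UNIV. f z - g z \<noteq> 0)"
    by (rule meromorphic_imp_constant_or_avoid) auto
  moreover have "\<not> (\<forall>\<^sub>\<approx>z\<in>UNIV. f z - g z \<noteq> 0)"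
  proof
    assume "\<forall>\<^sub>\<approx>z\<in>UNIV. f z - g z \<noteq> 0"
    from cosparse_compose_entire[OF v this] eq have "\<forall>\<^sub>\<approx>z\<in>(UNIV::complex set). False"
      by eventually_elim simp
    then show False by simp
  qed
  ultimately show ?thesis by simp
qed

lemma entire_eq_if_cosparse_eq:
  assumes "f holomorphic_on UNIV" "g holomorphic_on UNIV" "\<forall>\<^sub>\<approx>z\<in>UNIV. f z = g z"
  shows "f z = g z"
proof -
  have "\<forall>\<^sub>F w in at z. f w = g w" using assms(3) eventually_cosparse_imp_eventually_at by blast
  then have "f \<midarrow>z\<rightarrow> g z"
    using tendsto_cong[of f g "at z" "g z"] entire_tendsto[OF assms(2)] by blast
  with entire_tendsto[OF assms(1)] show ?thesis by (rule LIM_unique)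
qed

lemma is_pole_eventually_large:
  assumes "is_pole f z"
  shows "\<forall>\<^sub>F w in at z. norm (f w) > B"
  using assms unfolding is_pole_def filterlim_at_infinity_conv_norm_at_top
  by (simp add: filterlim_at_top_dense)

lemma analytic_locally_bounded:
  assumes "f analytic_on {z}"
  shows "\<exists>B. \<forall>\<^sub>F w in at z. norm (f w) \<le> B"
proof -
  have "f \<midarrow>z\<rightarrow> f z" using analytic_at_imp_isCont[OF assms] by (rule isContD)
  then have "((\<lambda>w. norm (f w)) \<longlongrightarrow> norm (f z)) (at z)" by (rule tendsto_norm)
  then have "\<forall>\<^sub>F w in at z. norm (f w) < norm (f z) + 1" by (rule order_tendstoD) simp
  then have "\<forall>\<^sub>F w in at z. norm (f w) \<le> norm (f z) + 1" by eventually_elim simp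
  then show ?thesis by blast
qed

lemma remove_sings_analytic_if_not_pole:
  assumes "f meromorphic_on UNIV" "\<not> is_pole f z"
  shows "remove_sings f analytic_on {z}"
proof (rule nicely_meromorphic_on_imp_analytic_at)
  show "remove_sings f nicely_meromorphic_on UNIV"
    using assms(1) by (rule remove_sings_nicely_meromorphic)
  show "\<not> is_pole (remove_sings f) z"
    using assms by (subst is_pole_remove_sings_iff) (auto simp: meromorphic_on_altdef)
qed auto

lemma entire_if_locally_bounded:
  assumes f: "f meromorphic_on UNIV"
    and b: "\<And>z. \<exists>B. \<forall>\<^sub>F w in at z. norm (f w) \<le> B"
  shows "remove_sings f holomorphic_on UNIV"
proof -
  have "remove_sings f analytic_on {z}" for z
  proof (rule remove_sings_analytic_if_not_pole[OF f])
    obtain B where B: "\<forall>\<^sub>F w in at z. norm (f w) \<le> B" using b by blast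
    show "\<not> is_pole f z"
    proof
      assume "is_pole f z"
      then have "\<forall>\<^sub>F w in at z. norm (f w) > B" by (rule is_pole_eventually_large)
      with B have "\<forall>\<^sub>F w in at z. False" by eventually_elim auto
      then show False by simp
    qed
  qed
  then have "remove_sings f analytic_on UNIV" using analytic_on_analytic_at by blast
  then show ?thesis by (rule analytic_imp_holomorphic)
qed

lemma bounded_mero_constant:
  assumes f: "f meromorphic_on UNIV"
    and b: "\<forall>\<^sub>\<approx>z\<in>UNIV. norm (f z) \<le> B"
  shows "\<exists>c. mero_eq f (\<lambda>_. c)"
proof -
  have ev: "\<forall>\<^sub>F w in at z. norm (f w) \<le> B" for z
    using b eventually_cosparse_imp_eventually_at by blast
  have hol: "remove_sings f holomorphic_on UNIV"
    by (rule entire_if_locally_bounded[OF f]) (use ev in blast)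
  have "norm (remove_sings f z) \<le> B" for z
  proof -
    have "remove_sings f \<midarrow>z\<rightarrow> remove_sings f z"
      by (rule entire_tendsto[OF hol])
    moreover have "\<forall>\<^sub>F w in at z. norm (remove_sings f w) \<le> B"
    proof -
      have "isolated_singularity_at f z" using f by (auto simp: meromorphic_on_altdef)
      from eventually_remove_sings_eq_at[OF this] ev[of z] show ?thesis
        by eventually_elim simp
    qed
    ultimately show ?thesis
      using Lim_norm_ubound[of "at z" "remove_sings f" "remove_sings f z" B] by simp
  qed
  then have "bounded (range (remove_sings f))" by (auto simp: bounded_iff)
  then have "remove_sings f constant_on UNIV" by (rule Liouville_theorem[OF hol])
  then show ?thesis
    using remove_sings_constant_on_open_iff[OF f] by (simp add: mero_eq_def)
qed

text \<open>The Casorati-Weierstrass argument: if f stayed away from a, then 1/(f - a) would be bounded.\<close>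

lemma mero_values_dense:
  assumes f: "f meromorphic_on UNIV" "\<not> (\<exists>c. mero_eq f (\<lambda>_. c))"
    and Q: "\<forall>\<^sub>\<approx>z\<in>UNIV. Q z" and U: "open U" "U \<noteq> {}"
  shows "\<exists>z. Q z \<and> f z \<in> U"
proof (rule ccontr)
  assume neg: "\<not> ?thesis"
  obtain a e where e: "e > 0" "ball a e \<subseteq> U"
  proof -
    obtain a where "a \<in> U" using U by blast
    with openE[OF U(1) this] that show ?thesis by blast
  qed
  have m: "(\<lambda>z. 1 / (f z - a)) meromorphic_on UNIV"
    by (intro meromorphic_intros f)
  have "\<forall>\<^sub>\<approx>z\<in>UNIV. norm (1 / (f z - a)) \<le> 1 / e"
    using Q
  proof eventually_elim
    case (elim z)
    then have "f z \<notin> ball a e" using neg e by blast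
    then have "norm (f z - a) \<ge> e" by (auto simp: dist_norm norm_minus_commute)
    then show ?case using e by (simp add: norm_divide frac_le)
  qed
  from bounded_mero_constant[OF m this] obtain c where
    c: "\<forall>\<^sub>\<approx>z\<in>UNIV. 1 / (f z - a) = c" by (auto simp: mero_eq_def)
  then have "\<forall>\<^sub>\<approx>z\<in>UNIV. f z = (if c = 0 then a else a + 1 / c)"
    by eventually_elim (auto simp: field_simps)
  then show False using f(2) by (auto simp: mero_eq_def)
qed

lemma mero_cube_root_of_unity:
  assumes f: "f meromorphic_on UNIV" and c: "\<forall>\<^sub>\<approx>z\<in>UNIV. f z ^ 3 = 1"
  shows "\<exists>r. r ^ 3 = 1 \<and> mero_eq f (\<lambda>_. r)"
proof -
  have "\<forall>\<^sub>\<approx>z\<in>UNIV. norm (f z) \<le> 1"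
    using c
  proof eventually_elim
    case (elim z)
    then have "norm (f z) ^ 3 = 1" by (metis norm_one norm_power)
    then show ?case using one_less_power[of "norm (f z)" 3] by linarith
  qed
  from bounded_mero_constant[OF f this] obtain r where r: "mero_eq f (\<lambda>_. r)" by blast
  have "\<forall>\<^sub>\<approx>z\<in>(UNIV::complex set). r ^ 3 = 1"
    using c r unfolding mero_eq_def by eventually_elim simp
  then have "r ^ 3 = 1" by simp
  with r show ?thesis by blast
qed

section \<open>Local lifts and uniqueness for first-order equations\<close>

lemma local_lift:
  assumes F: "F analytic_on {w0}" "deriv F w0 \<noteq> 0"
    and f: "f analytic_on {z0}" "f z0 = F w0"
  obtains k where "k analytic_on {z0}" "k z0 = w0" "\<forall>\<^sub>F z in nhds z0. F (k z) = f z"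
proof -
  obtain S where S: "open S" "w0 \<in> S" "F holomorphic_on S"
    using F(1) by (auto simp: analytic_at)
  obtain r where r: "r > 0" "ball w0 r \<subseteq> S" "inj_on F (ball w0 r)"
    using has_complex_derivative_locally_injective[OF S(3,2,1) F(2)] .
  have hol: "F holomorphic_on ball w0 r" using S r holomorphic_on_subset by blast
  obtain g where g: "g holomorphic_on (F ` ball w0 r)" "\<And>z. z \<in> ball w0 r \<Longrightarrow> g (F z) = z"
    using holomorphic_has_inverse[OF hol open_ball r(3)] by metis
  have op: "open (F ` ball w0 r)" by (rule open_mapping_thm3[OF hol open_ball r(3)])
  have in0: "f z0 \<in> F ` ball w0 r" using f r by auto
  have ga: "g analytic_on {f z0}" using g op in0 by (auto simp: analytic_at)
  have ka: "(g \<circ> f) analytic_on {z0}"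
    by (rule analytic_on_compose_gen[OF f(1) ga]) auto
  have "\<forall>\<^sub>F z in nhds z0. f z \<in> F ` ball w0 r"
    using analytic_tendsto_nhds[OF f(1)] op in0 by (auto simp: tendsto_def)
  then have "\<forall>\<^sub>F z in nhds z0. F ((g \<circ> f) z) = f z"
    by eventually_elim (use g in auto)
  with ka show ?thesis using that[of "g \<circ> f"] g(2)[of w0] f(2) r(1) by auto
qed

lemma analytic_root_of_unity_constant:
  fixes f :: "complex \<Rightarrow> complex"
  assumes f: "f analytic_on {z0}" and n: "n > 0" and ev: "\<forall>\<^sub>F z in nhds z0. f z ^ n = 1"
  shows "\<forall>\<^sub>F z in nhds z0. f z = f z0"
proof -
  obtain S where S: "open S" "z0 \<in> S" "f holomorphic_on S"
    using f(1) by (auto simp: analytic_at)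
  obtain T where T: "open T" "z0 \<in> T" "\<And>z. z \<in> T \<Longrightarrow> f z ^ n = 1"
    using ev by (auto simp: eventually_nhds)
  obtain e where e: "e > 0" "ball z0 e \<subseteq> S \<inter> T"
    using openE[of "S \<inter> T" z0] S T by auto
  have "f constant_on ball z0 e"
  proof (rule continuous_finite_range_constant)
    show "continuous_on (ball z0 e) f"
      using continuous_on_subset[OF holomorphic_on_imp_continuous_on[OF S(3)]] e by blast
    have "f ` ball z0 e \<subseteq> {w. w ^ n = 1}" using T e by auto
    then show "finite (f ` ball z0 e)"
      using finite_roots_unity[of n] n by (auto intro: finite_subset)
  qed auto
  then have "\<And>z. z \<in> ball z0 e \<Longrightarrow> f z = f z0"
    using e by (auto simp: constant_on_def)
  moreover have "\<forall>\<^sub>F z in nhds z0. z \<in> ball z0 e"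
    using e by (intro eventually_nhds_in_open) auto
  ultimately show ?thesis by (rule eventually_mono[rotated])
qed

lemma eventually_eq_if_deriv_eq:
  assumes "f analytic_on {z0}" "g analytic_on {z0}" "f z0 = g z0"
    and ev: "\<forall>\<^sub>F z in nhds z0. deriv f z = deriv g z"
  shows "\<forall>\<^sub>F z in nhds z0. f z = g z"
proof -
  have "\<forall>\<^sub>F z in nhds z0. ((\<lambda>z. f z - g z) has_field_derivative 0) (at z)"
    using ev analytic_eventually_analytic[OF assms(1)] analytic_eventually_analytic[OF assms(2)]
  proof eventually_elim
    case (elim z)
    then show ?case
      using DERIV_diff[OF analytic_derivI[OF elim(2)] analytic_derivI[OF elim(3)]] by simp
  qed
  then obtain S where S: "open S" "z0 \<in> S" "\<And>z. z \<in> S \<Longrightarrow> ((\<lambda>z. f z - g z) has_field_derivative 0) (at z)"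
    by (auto simp: eventually_nhds)
  obtain e where e: "e > 0" "ball z0 e \<subseteq> S" using S by (auto elim: openE)
  have "((\<lambda>z. f z - g z) has_field_derivative 0) (at x within ball z0 e)" if "x \<in> ball z0 e" for x
    using S(3) that e has_field_derivative_at_within by blast
  then have "\<exists>c. \<forall>x\<in>ball z0 e. f x - g x = c"
    by (intro has_field_derivative_zero_constant) auto
  then obtain c where c: "\<And>x. x \<in> ball z0 e \<Longrightarrow> f x - g x = c" by blast
  have "f z = g z" if "z \<in> ball z0 e" for z
    using c[OF that] c[of z0] e assms(3) by simp
  moreover have "\<forall>\<^sub>F z in nhds z0. z \<in> ball z0 e" using e by (intro eventually_nhds_in_open) auto
  ultimately show ?thesis by (rule eventually_mono[rotated])
qed

text \<open>Separation of variables: a nonzero slope makes v locally invertible, so u = v(k)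
  for some analytic k, and the two equations force k'^n = 1. Since k' = 1 at the initial point, k
  is the identity. The function R expresses that the values determine both slopes up to a root of
  unity.\<close>

lemma ode_unique:
  assumes u: "u analytic_on {z0}" and v: "v analytic_on {z0}"
    and init: "u z0 = v z0" "deriv u z0 = deriv v z0" "deriv v z0 \<noteq> 0"
    and n: "n > 0"
    and odeu: "\<forall>\<^sub>F z in nhds z0. deriv u z ^ n = R (u z)"
    and odev: "\<forall>\<^sub>F z in nhds z0. deriv v z ^ n = R (v z)"
  shows "\<forall>\<^sub>F z in nhds z0. u z = v z"
proof -
  obtain k where k: "k analytic_on {z0}" "k z0 = z0" and vk: "\<forall>\<^sub>F z in nhds z0. v (k z) = u z"
    using local_lift[OF v init(3) u init(1)] by metis
  have kc: "filterlim k (nhds z0) (nhds z0)"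
    using analytic_tendsto_nhds[OF k(1)] k(2) by simp
  note eva = analytic_eventually_analytic
  have vk': "\<forall>\<^sub>F z in nhds z0. \<forall>\<^sub>F z in nhds z. v (k z) = u z"
    using vk by (simp add: eventually_eventually)
  have ev_va: "\<forall>\<^sub>F z in nhds z0. v analytic_on {k z}"
    using eva[OF v] kc by (rule eventually_compose_filterlim)
  (* The chain rule for v o k = u, read together with the two equations, makes the derivative of k
     an n-th root of unity. *)
  have d: "\<forall>\<^sub>F z in nhds z0. deriv v (k z) * deriv k z = deriv u z"
    using vk' ev_va eva[OF k(1)]
  proof eventually_elim
    case (elim z)
    have 1: "(v has_field_derivative deriv v (k z)) (at (k z))"
      using elim(2) by (simp add: analytic_derivI)
    have 2: "(k has_field_derivative deriv k z) (at z)"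
      using elim(3) by (simp add: analytic_derivI)
    have "((\<lambda>z. v (k z)) has_field_derivative deriv v (k z) * deriv k z) (at z)"
      by (rule DERIV_chain2[OF 1 2])
    then have "deriv (\<lambda>z. v (k z)) z = deriv v (k z) * deriv k z" by (rule DERIV_imp_deriv)
    moreover have "deriv (\<lambda>z. v (k z)) z = deriv u z"
      using elim(1) by (intro deriv_cong_ev) auto
    ultimately show ?case by simp
  qed
  have k'0: "deriv k z0 = 1"
    using eventually_nhds_x_imp_x[OF d] init k(2) by simp
  have nz: "\<forall>\<^sub>F z in nhds z0. deriv u z \<noteq> 0"
  proof -
    have "deriv u analytic_on {z0}" using u by (rule analytic_deriv)
    then have "(deriv u \<longlongrightarrow> deriv u z0) (nhds z0)" by (rule analytic_tendsto_nhds)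
    then show ?thesis using init by (intro tendsto_imp_eventually_ne[of _ "deriv u z0"]) auto
  qed
  have odevk: "\<forall>\<^sub>F z in nhds z0. deriv v (k z) ^ n = R (v (k z))"
    using odev kc by (rule eventually_compose_filterlim)
  have "\<forall>\<^sub>F z in nhds z0. deriv k z ^ n = 1"
    using d nz odevk odeu vk
  proof eventually_elim
    case (elim z)
    then have "deriv v (k z) ^ n * deriv k z ^ n = deriv v (k z) ^ n"
      by (metis power_mult_distrib)
    moreover have "deriv v (k z) \<noteq> 0" using elim by auto
    ultimately show ?case by simp
  qed
  then have k': "\<forall>\<^sub>F z in nhds z0. deriv k z = 1"
    using analytic_root_of_unity_constant[OF analytic_deriv[OF k(1)] n] k'0 by simp
  then have "\<forall>\<^sub>F z in nhds z0. deriv k z = deriv (\<lambda>z. z) z" by simp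
  then have "\<forall>\<^sub>F z in nhds z0. k z = z"
    using eventually_eq_if_deriv_eq[OF k(1), of "\<lambda>z. z"] k(2) by simp
  with vk show ?thesis by eventually_elim simp
qed

section \<open>Entire maps semiconjugate to an isometry\<close>

text \<open>Cauchy's inequality on discs of radius R n / 2 makes the derivative vanish.\<close>

lemma entire_sublinear_constant:
  fixes h :: "complex \<Rightarrow> complex"
  assumes h: "h holomorphic_on UNIV"
    and R: "filterlim R at_top sequentially"
    and bound: "\<And>n w. norm w \<le> R n \<Longrightarrow> norm (h w) \<le> B n"
    and small: "(\<lambda>n. B n / R n) \<longlonglongrightarrow> 0"
  shows "h constant_on UNIV"
proof -
  have "deriv h a = 0" for a
  proof -
    have "norm (deriv h a) \<le> 2 * (B n / R n)" if n: "R n \<ge> 2 * norm a + 1" for n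
    proof -
      have pos: "R n > 0" "R n / 2 > 0" using n norm_ge_zero[of a] by linarith+
      have "norm ((deriv ^^ 1) h a) \<le> fact 1 * B n / (R n / 2) ^ 1"
      proof (rule Cauchy_inequality)
        show "h holomorphic_on ball a (R n / 2)" using h holomorphic_on_subset by blast
        show "continuous_on (cball a (R n / 2)) h"
          using holomorphic_on_imp_continuous_on[OF h] continuous_on_subset by blast
        fix x assume "norm (a - x) = R n / 2"
        then have "norm x \<le> R n"
          using n norm_triangle_ineq2[of x a] by (simp add: norm_minus_commute)
        then show "norm (h x) \<le> B n" by (rule bound)
      qed (use pos in auto)
      then show ?thesis by (simp add: mult.commute)
    qed
    moreover have "\<forall>\<^sub>F n in sequentially. R n \<ge> 2 * norm a + 1"
      using R by (simp add: filterlim_at_top)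
    ultimately have "\<forall>\<^sub>F n in sequentially. norm (deriv h a) \<le> 2 * (B n / R n)"
      by (rule eventually_mono[rotated])
    moreover have "(\<lambda>n. 2 * (B n / R n)) \<longlonglongrightarrow> 2 * 0"
      by (intro tendsto_mult tendsto_const small)
    ultimately have "norm (deriv h a) \<le> 2 * 0"
      by (intro tendsto_lowerbound[where F=sequentially]) auto
    then show ?thesis by simp
  qed
  then have "(h has_field_derivative 0) (at x within UNIV)" for x
    using holomorphic_derivI[OF h open_UNIV, of x] by simp
  then have "\<exists>c. \<forall>x\<in>UNIV. h x = c"
    by (intro has_field_derivative_zero_constant) auto
  then show ?thesis by (simp add: constant_on_def)
qed

text \<open>The maximum of |h| over the disc of radius \<rho>^n r0 is O(n), hence sublinear in the radius.\<close>

lemma additive_growth_constant: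
  fixes h :: "complex \<Rightarrow> complex"
  assumes h: "h holomorphic_on UNIV" and \<rho>: "\<rho> > 1" and r0: "r0 > 0"
    and step: "\<And>r K w. r \<ge> r0 \<Longrightarrow> (\<And>w. norm w \<le> r \<Longrightarrow> norm (h w) \<le> K) \<Longrightarrow>
                 norm w \<le> \<rho> * r \<Longrightarrow> norm (h w) \<le> K + b"
  shows "h constant_on UNIV"
proof -
  have "continuous_on (cball 0 r0) h"
    using holomorphic_on_imp_continuous_on[OF h] continuous_on_subset by blast
  then have "bounded (h ` cball 0 r0)"
    by (intro compact_imp_bounded compact_continuous_image) auto
  then obtain K where K: "\<And>w. norm w \<le> r0 \<Longrightarrow> norm (h w) \<le> K"
    unfolding bounded_iff by (metis (no_types) image_eqI mem_cball_0)
  have bound: "norm (h w) \<le> K + real n * b" if "norm w \<le> \<rho> ^ n * r0" for n w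
    using that
  proof (induction n arbitrary: w)
    case 0 then show ?case using K by simp
  next
    case (Suc n)
    have "norm (h w) \<le> (K + real n * b) + b"
    proof (rule step)
      show "r0 \<le> \<rho> ^ n * r0" using \<rho> r0 by simp
      show "norm w \<le> \<rho> * (\<rho> ^ n * r0)" using Suc.prems by simp
    qed (use Suc.IH in blast)
    then show ?case by (simp add: algebra_simps)
  qed
  show ?thesis
  proof (rule entire_sublinear_constant[OF h _ bound])
    have "filterlim (\<lambda>n. \<rho> ^ n) at_top sequentially"
      using filterlim_realpow_sequentially_gt1[of \<rho>] \<rho>
      by (simp add: filterlim_at_infinity_conv_norm_at_top)
    then show "filterlim (\<lambda>n. \<rho> ^ n * r0) at_top sequentially"
      using r0 by (subst mult.commute) (rule filterlim_tendsto_pos_mult_at_top[OF tendsto_const])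
    have "(\<lambda>n. (K / r0) * (1 / \<rho> ^ n) + (b / r0) * (real n * (1 / \<rho>) ^ n)) \<longlonglongrightarrow> (K / r0) * 0 + (b / r0) * 0"
    proof (intro tendsto_add tendsto_mult tendsto_const)
      show "(\<lambda>n. 1 / \<rho> ^ n) \<longlonglongrightarrow> 0"
        using LIMSEQ_realpow_zero[of "1 / \<rho>"] \<rho> by (simp add: power_divide)
      show "(\<lambda>n. real n * (1 / \<rho>) ^ n) \<longlonglongrightarrow> 0"
        using powser_times_n_limit_0[of "1 / \<rho>"] \<rho> by simp
    qed
    moreover have "(K + real n * b) / (\<rho> ^ n * r0) =
        (K / r0) * (1 / \<rho> ^ n) + (b / r0) * (real n * (1 / \<rho>) ^ n)" for n
      using \<rho> r0 by (simp add: field_simps power_divide)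
    ultimately show "(\<lambda>n. (K + real n * b) / (\<rho> ^ n * r0)) \<longlonglongrightarrow> 0" by simp
  qed
qed

lemma contraction_bound_constant:
  fixes h :: "complex \<Rightarrow> complex"
  assumes h: "h holomorphic_on UNIV" and q: "norm q < 1"
    and bound: "\<And>w::complex. norm (h w) \<le> norm (h (q * w + c)) + b"
  shows "h constant_on UNIV"
proof -
  (* A ratio with 1 < \<rho> and |q| \<rho> < 1, and a radius beyond which w -> q w + c maps the disc of
     radius \<rho> r into the disc of radius r. *)
  define \<rho> where "\<rho> = 2 / (1 + norm q)"
  have \<rho>: "\<rho> > 1" "norm q * \<rho> < 1"
    using q norm_ge_zero[of q] unfolding \<rho>_def by (simp_all add: field_simps add_pos_nonneg del: norm_ge_zero)
  define r0 where "r0 = (norm c + 1) / (1 - norm q * \<rho>)"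
  have r0: "r0 > 0" using \<rho> norm_ge_zero[of c] by (simp add: r0_def add_nonneg_pos del: norm_ge_zero)
  show ?thesis
  proof (rule additive_growth_constant[OF h \<rho>(1) r0])
    fix r K and w :: complex
    assume r: "r \<ge> r0" and K: "\<And>w. norm w \<le> r \<Longrightarrow> norm (h w) \<le> K"
      and w: "norm w \<le> \<rho> * r"
    have "norm (q * w + c) \<le> norm q * norm w + norm c"
      by (metis norm_mult norm_triangle_ineq)
    also have "\<dots> \<le> norm q * (\<rho> * r) + norm c" using w by (simp add: mult_left_mono)
    also have "\<dots> \<le> r"
    proof -
      have "norm c + 1 = r0 * (1 - norm q * \<rho>)" using \<rho> by (simp add: r0_def)
      also have "\<dots> \<le> r * (1 - norm q * \<rho>)" using r \<rho> by (simp add: mult_right_mono)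
      finally show ?thesis by (simp add: algebra_simps)
    qed
    finally have "norm (h (q * w + c)) \<le> K" by (rule K)
    then show "norm (h w) \<le> K + b" using bound[of w] by linarith
  qed
qed

text \<open>A weak form of Bohr's theorem on the circles contained in the image of a disc. If L omitted a
  value on each of the circles of radius 2 R and 3 R, Schottky's theorem would bound L on the half
  disc by a universal multiple of R.\<close>

lemma schottky_circle:
  obtains C :: real where "C > 0"
    "\<And>L r R. L holomorphic_on UNIV \<Longrightarrow> r > 0 \<Longrightarrow> R > 0 \<Longrightarrow> norm (L 0) \<le> R \<Longrightarrow>
        (\<exists>z. norm z \<le> r / 2 \<and> norm (L z) > C * R) \<Longrightarrow>
        \<exists>s \<ge> 2 * R. sphere 0 s \<subseteq> L ` cball 0 r"
proof -
  define K where "K = exp (pi * exp (pi * (2 + 2 * 3 + 12 * (1/2) / (1 - 1/2))))"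
  define C where "C = 2 + 5 * K"
  have K: "K > 0" by (simp add: K_def)
  have "\<exists>s \<ge> 2 * R. sphere 0 s \<subseteq> L ` cball 0 r"
    if L: "L holomorphic_on UNIV" and r: "r > 0" and R: "R > 0" "norm (L 0) \<le> R"
      and big: "\<exists>z. norm z \<le> r / 2 \<and> norm (L z) > C * R" for L r R
  proof (rule ccontr)
    assume neg: "\<not> ?thesis"
    have "\<not> sphere 0 (2 * R) \<subseteq> L ` cball 0 r" "\<not> sphere 0 (3 * R) \<subseteq> L ` cball 0 r"
      using neg R by auto
    then obtain \<alpha> \<beta> where ab: "norm \<alpha> = 2 * R" "\<alpha> \<notin> L ` cball 0 r" "norm \<beta> = 3 * R" "\<beta> \<notin> L ` cball 0 r"
      unfolding subset_iff mem_sphere_0 by blast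
    have d: "norm (\<beta> - \<alpha>) \<ge> R" "norm (\<beta> - \<alpha>) \<le> 5 * R"
      using norm_triangle_ineq2[of \<beta> \<alpha>] norm_triangle_ineq4[of \<beta> \<alpha>] ab by auto
    then have dp: "norm (\<beta> - \<alpha>) > 0" "\<beta> - \<alpha> \<noteq> 0" using R by auto
    obtain z where z: "norm z \<le> r / 2" "norm (L z) > C * R" using big by blast
    (* Normalise the two omitted values to 0 and 1. *)
    define g where "g = (\<lambda>x. (L (of_real r * x) - \<alpha>) / (\<beta> - \<alpha>))"
    have inr: "of_real r * x \<in> cball 0 r" if "x \<in> cball 0 1" for x :: complex
      using that r by (simp add: norm_mult mult_left_le)
    have "norm (g (z / of_real r)) \<le> exp (pi * exp (pi * (2 + 2 * 3 + 12 * (1/2) / (1 - 1/2))))"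
    proof (rule Schottky[where f = g and t = "1/2" and r = 3 and z = "z / of_real r"])
      have Lc: "(\<lambda>x. L (of_real r * x)) holomorphic_on cball 0 1"
        using holomorphic_on_compose_gen[of "\<lambda>x. of_real r * x" "cball 0 1" L UNIV] L
        by (auto simp: o_def intro: holomorphic_intros)
      show "g holomorphic_on cball 0 1"
        unfolding g_def using dp by (intro holomorphic_intros Lc) auto
      have "norm (L 0 - \<alpha>) \<le> 3 * R" using norm_triangle_ineq4[of "L 0" \<alpha>] ab R by linarith
      also have "\<dots> \<le> 3 * norm (\<beta> - \<alpha>)" using d by simp
      finally show "norm (g 0) \<le> 3" using dp by (simp add: g_def norm_divide divide_le_eq)
      fix x :: complex assume "x \<in> cball 0 1"
      then have "L (of_real r * x) \<noteq> \<alpha>" "L (of_real r * x) \<noteq> \<beta>"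
        using inr ab by blast+
      then show "\<not> (g x = 0 \<or> g x = 1)" using dp by (auto simp: g_def divide_simps)
    next
      show "norm (z / of_real r) \<le> 1 / 2" using z r by (simp add: norm_divide field_simps)
    qed auto
    then have "norm (L z - \<alpha>) \<le> K * norm (\<beta> - \<alpha>)"
      using r dp by (simp add: g_def K_def norm_divide field_simps)
    also have "\<dots> \<le> K * (5 * R)" using d K by simp
    finally have "norm (L z) \<le> 2 * R + K * (5 * R)"
      using norm_triangle_ineq2[of "L z" \<alpha>] ab by linarith
    then show False using z by (simp add: C_def algebra_simps)
  qed
  moreover have "C > 0" using K by (simp add: C_def)
  ultimately show ?thesis using that by blast
qed

lemma nonlinear_growth:
  fixes L :: "complex \<Rightarrow> complex"
  assumes L: "L holomorphic_on UNIV" and nl: "\<not> (\<exists>q c. \<forall>z. L z = q * z + c)"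
  shows "\<exists>r1. \<forall>r\<ge>r1. \<exists>z. norm z \<le> r / 2 \<and> norm (L z) > C * r"
proof -
  have hd: "deriv L holomorphic_on UNIV" "deriv (deriv L) holomorphic_on UNIV"
    using L by (auto intro!: holomorphic_deriv)
  have "\<exists>a. deriv (deriv L) a \<noteq> 0"
  proof (rule ccontr)
    assume "\<not> ?thesis"
    then have "(deriv L has_field_derivative 0) (at x within UNIV)" for x
      using holomorphic_derivI[OF hd(1) open_UNIV, of x] by simp
    then have "\<exists>c. \<forall>x\<in>UNIV. deriv L x = c"
      by (intro has_field_derivative_zero_constant) auto
    then obtain q where q: "\<And>x. deriv L x = q" by blast
    have "((\<lambda>x. L x - q * x) has_field_derivative 0) (at x within UNIV)" for x
      using DERIV_diff[OF holomorphic_derivI[OF L open_UNIV UNIV_I, of x] DERIV_cmult[OF DERIV_ident, of q x]]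
      by (simp add: q)
    then have "\<exists>c. \<forall>x\<in>UNIV. L x - q * x = c"
      by (intro has_field_derivative_zero_constant) auto
    then obtain c where "\<And>x. L x - q * x = c" by blast
    then have "\<forall>x. L x = q * x + c" by (metis add.commute diff_add_cancel)
    then show False using nl by blast
  qed
  then obtain a where a: "deriv (deriv L) a \<noteq> 0" by blast
  define d where "d = norm (deriv (deriv L) a)"
  have d: "d > 0" using a by (simp add: d_def)
  (* The disc of radius r / 4 about a lies in the disc of radius r / 2 about 0, and Cauchy's
     inequality there gives d <= 32 C / r unless L is large. *)
  define r1 where "r1 = max (4 * norm a + 1) (max 0 (32 * C / d) + 1)"
  have "\<exists>z. norm z \<le> r / 2 \<and> norm (L z) > C * r" if r: "r \<ge> r1" for r
  proof (rule ccontr)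
    assume neg: "\<not> ?thesis"
    have rp: "r > 0" "r / 4 \<ge> norm a" using r norm_ge_zero[of a] unfolding r1_def by linarith+
    have "norm ((deriv ^^ 2) L a) \<le> fact 2 * (C * r) / (r / 4) ^ 2"
    proof (rule Cauchy_inequality)
      show "L holomorphic_on ball a (r / 4)" using L holomorphic_on_subset by blast
      show "continuous_on (cball a (r / 4)) L"
        using holomorphic_on_imp_continuous_on[OF L] continuous_on_subset by blast
      fix x assume "norm (a - x) = r / 4"
      then have "norm x \<le> r / 2"
        using rp norm_triangle_ineq2[of x a] by (simp add: norm_minus_commute)
      then show "norm (L x) \<le> C * r" using neg by (meson not_le)
    qed (use rp in auto)
    also have "(deriv ^^ 2) L a = deriv (deriv L) a" by (simp add: numeral_2_eq_2)
    also have "fact 2 * (C * r) / (r / 4) ^ 2 = 32 * C / r"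
      using rp by (simp add: power2_eq_square field_simps)
    finally have "d * r \<le> 32 * C" using rp by (simp add: d_def field_simps)
    moreover have "d * r > 32 * C"
    proof -
      have "r > 32 * C / d" using r unfolding r1_def by linarith
      then show ?thesis using d by (simp add: field_simps)
    qed
    ultimately show False by simp
  qed
  then show ?thesis by blast
qed

text \<open>The relation bounds h(L z) by h(z) plus a constant, and conversely. For nonlinear L the maximum
  principle spreads this bound from a circle inside the image of a disc to the disc of twice the
  radius.\<close>

lemma semiconjugate_to_isometry_imp_linear:
  fixes h L :: "complex \<Rightarrow> complex"
  assumes h: "h holomorphic_on UNIV" "\<not> h constant_on UNIV"
    and L: "L holomorphic_on UNIV" "\<not> L constant_on UNIV"
    and A: "norm A = 1" and eq: "\<And>z. h (L z) = A * h z + b"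
  shows "\<exists>q c. norm q = 1 \<and> (\<forall>z. L z = q * z + c)"
proof -
  have up: "norm (h (L z)) \<le> norm (h z) + norm b" for z
    using norm_triangle_ineq[of "A * h z" b] A by (simp add: eq norm_mult)
  have down: "norm (h z) \<le> norm (h (L z)) + norm b" for z
    using norm_triangle_ineq4[of "h (L z)" b] A by (simp add: eq norm_mult)
  show ?thesis
  proof (cases "\<exists>q c. \<forall>z. L z = q * z + c")
    case True
    then obtain q c where qc: "\<And>z. L z = q * z + c" by blast
    have q0: "q \<noteq> 0" using L(2) qc by (auto simp: constant_on_def)
    have "\<not> norm q < 1"
      using contraction_bound_constant[OF h(1), of q c "norm b"] down h(2) by (auto simp: qc)
    moreover have "\<not> norm q > 1"
    proof
      assume "norm q > 1"
      then have q1: "norm (1 / q) < 1" using less_divide_eq_1_pos[of "norm q" 1] by (simp add: norm_divide divide_less_eq)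
      have "norm (h w) \<le> norm (h (1 / q * w + (- c / q))) + norm b" for w
        using up[of "1 / q * w + (- c / q)"] q0 by (simp add: qc field_simps)
      then show False using contraction_bound_constant[OF h(1) q1] h(2) by blast
    qed
    ultimately have "norm q = 1" by simp
    with qc show ?thesis by blast
  next
    case False
    obtain C :: real where C: "C > 0"
      "\<And>L r R. L holomorphic_on UNIV \<Longrightarrow> r > 0 \<Longrightarrow> R > 0 \<Longrightarrow> norm (L 0) \<le> R \<Longrightarrow>
          (\<exists>z. norm z \<le> r / 2 \<and> norm (L z) > C * R) \<Longrightarrow>
          \<exists>s \<ge> 2 * R. sphere 0 s \<subseteq> L ` cball 0 r"
      by (rule schottky_circle) blast
    obtain r1 where r1: "\<And>r. r \<ge> r1 \<Longrightarrow> \<exists>z. norm z \<le> r / 2 \<and> norm (L z) > C * r"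
      using nonlinear_growth[OF L(1) False] by blast
    define r0 where "r0 = max r1 (norm (L 0) + 1)"
    have "h constant_on UNIV"
    proof (rule additive_growth_constant[OF h(1), of 2 r0])
      show "r0 > 0" using norm_ge_zero[of "L 0"] unfolding r0_def by linarith
      fix r K and w :: complex
      assume r: "r \<ge> r0" and K: "\<And>w. norm w \<le> r \<Longrightarrow> norm (h w) \<le> K"
        and w: "norm w \<le> 2 * r"
      have rp: "r > 0" "norm (L 0) \<le> r" "r \<ge> r1" 
        using r norm_ge_zero[of "L 0"] unfolding r0_def by linarith+
      obtain s where s: "s \<ge> 2 * r" "sphere 0 s \<subseteq> L ` cball 0 r"
        using C(2)[OF L(1) rp(1) rp(1) rp(2) r1[OF rp(3)]] by blast
      show "norm (h w) \<le> K + norm b"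
      proof (rule maximum_modulus_frontier[of h "cball 0 s"])
        show "h holomorphic_on interior (cball 0 s)" using h(1) holomorphic_on_subset by blast
        show "continuous_on (closure (cball 0 s)) h"
          using holomorphic_on_imp_continuous_on[OF h(1)] continuous_on_subset by blast
        fix x :: complex assume "x \<in> frontier (cball 0 s)"
        then have "x \<in> sphere 0 s" by simp
        then obtain y where y: "x = L y" "norm y \<le> r" using s by auto
        have "norm (h y) \<le> K" using y(2) by (rule K)
        then show "norm (h x) \<le> K + norm b" using up[of y] unfolding y(1) by linarith
      qed (use w s in auto)
    qed auto
    with h(2) show ?thesis by blast
  qed
qed

section \<open>The lattice and the Weierstrass function\<close>

locale period_pair =
  fixes \<omega>\<^sub>1 \<omega>\<^sub>2 :: complex
  assumes indep: "Im (\<omega>\<^sub>1 / \<omega>\<^sub>2) \<noteq> 0"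
begin

definition lat :: "int \<times> int \<Rightarrow> complex" where
  "lat = (\<lambda>(m, n). of_int m * \<omega>\<^sub>1 + of_int n * \<omega>\<^sub>2)"

abbreviation "\<Lambda> \<equiv> period_lattice \<omega>\<^sub>1 \<omega>\<^sub>2"

abbreviation "P \<equiv> weierstrass_p \<omega>\<^sub>1 \<omega>\<^sub>2"

lemma lattice_eq_range: "\<Lambda> = range lat"
  by (auto simp: period_lattice_def lat_def image_def)

lemma lat_add: "lat (x + y) = lat x + lat y"
  by (auto simp: lat_def algebra_simps split: prod.splits)

lemma lat_uminus: "lat (- x) = - lat x"
  by (auto simp: lat_def algebra_simps split: prod.splits)

lemma lat_zero [simp]: "lat 0 = 0"
  by (simp add: lat_def zero_prod_def)

lemma lattice_zero [simp, intro]: "0 \<in> \<Lambda>"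
  unfolding lattice_eq_range using lat_zero by (metis rangeI)

lemma lattice_add [intro]: "a \<in> \<Lambda> \<Longrightarrow> b \<in> \<Lambda> \<Longrightarrow> a + b \<in> \<Lambda>"
  unfolding lattice_eq_range by (auto simp flip: lat_add)

lemma lattice_uminus_iff [simp]: "- a \<in> \<Lambda> \<longleftrightarrow> a \<in> \<Lambda>"
proof -
  have "- b \<in> \<Lambda>" if "b \<in> \<Lambda>" for b
    using that unfolding lattice_eq_range by (auto simp flip: lat_uminus)
  from this[of a] this[of "- a"] show ?thesis by auto
qed

lemma lattice_diff [intro]: "a \<in> \<Lambda> \<Longrightarrow> b \<in> \<Lambda> \<Longrightarrow> a - b \<in> \<Lambda>"
  using lattice_add[of a "-b"] by simp

lemma lattice_add_right_iff: "b \<in> \<Lambda> \<Longrightarrow> a + b \<in> \<Lambda> \<longleftrightarrow> a \<in> \<Lambda>"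
  using lattice_diff[of "a + b" b] by auto

text \<open>With q = \<omega>1/\<omega>2, the imaginary part of m q + n controls m, and then n is controlled as well.\<close>

lemma lat_norm_bound:
  obtains c where "c > 0" "\<And>m n. c * real_of_int (max \<bar>m\<bar> \<bar>n\<bar>) \<le> norm (lat (m, n))"
proof -
  define q where "q = \<omega>\<^sub>1 / \<omega>\<^sub>2"
  have w2: "\<omega>\<^sub>2 \<noteq> 0" and q: "\<bar>Im q\<bar> > 0" using indep by (auto simp: q_def)
  define K where "K = 1 / \<bar>Im q\<bar> + 1 + norm q / \<bar>Im q\<bar>"
  have K: "K > 0" using q by (simp add: K_def add_pos_nonneg)
  have "real_of_int (max \<bar>m\<bar> \<bar>n\<bar>) * norm \<omega>\<^sub>2 \<le> K * norm (lat (m, n))" for m n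
  proof -
    define X where "X = norm (of_int m * q + of_int n)"
    have X: "norm (lat (m, n)) = X * norm \<omega>\<^sub>2"
    proof -
      have "lat (m, n) = (of_int m * q + of_int n) * \<omega>\<^sub>2"
        using w2 by (simp add: lat_def q_def field_simps)
      then show ?thesis by (simp add: X_def norm_mult)
    qed
    have X0: "X \<ge> 0" by (simp add: X_def)
    have "\<bar>Im (of_int m * q + of_int n)\<bar> \<le> X" unfolding X_def by (rule abs_Im_le_cmod)
    then have m1: "\<bar>real_of_int m\<bar> * \<bar>Im q\<bar> \<le> X" by (simp add: abs_mult)
    then have m: "\<bar>real_of_int m\<bar> \<le> X / \<bar>Im q\<bar>" using q by (simp add: field_simps)
    have "\<bar>real_of_int n\<bar> = norm ((of_int m * q + of_int n) - of_int m * q)" by simp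
    also have "\<dots> \<le> X + \<bar>real_of_int m\<bar> * norm q"
      unfolding X_def by (metis norm_mult norm_of_int norm_triangle_ineq4)
    also have "\<dots> \<le> X + X / \<bar>Im q\<bar> * norm q" using mult_right_mono[OF m, of "norm q"] by simp
    finally have n: "\<bar>real_of_int n\<bar> \<le> X + X / \<bar>Im q\<bar> * norm q" .
    have KX: "K * X = X / \<bar>Im q\<bar> + (X + X / \<bar>Im q\<bar> * norm q)" by (simp add: K_def algebra_simps)
    have "X / \<bar>Im q\<bar> \<ge> 0" "X / \<bar>Im q\<bar> * norm q \<ge> 0" using X0 by auto
    then have "\<bar>real_of_int m\<bar> \<le> K * X" "\<bar>real_of_int n\<bar> \<le> K * X"
      using m n X0 unfolding KX by linarith+
    then have "real_of_int (max \<bar>m\<bar> \<bar>n\<bar>) \<le> K * X" by (simp add: max_def)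
    from mult_right_mono[OF this, of "norm \<omega>\<^sub>2"] show ?thesis unfolding X by (simp add: mult.assoc)
  qed
  then have "norm \<omega>\<^sub>2 / K * real_of_int (max \<bar>m\<bar> \<bar>n\<bar>) \<le> norm (lat (m, n))" for m n
    using K by (simp add: field_simps)
  moreover have "norm \<omega>\<^sub>2 / K > 0" using K w2 by simp
  ultimately show ?thesis using that by blast
qed

lemma finite_lat_bounded: "finite {x. norm (lat x) \<le> R}"
proof -
  obtain c where c: "c > 0" "\<And>m n. c * real_of_int (max \<bar>m\<bar> \<bar>n\<bar>) \<le> norm (lat (m, n))"
    by (rule lat_norm_bound) blast
  define N where "N = \<lfloor>R / c\<rfloor>"
  have "{x. norm (lat x) \<le> R} \<subseteq> {-N..N} \<times> {-N..N}"
  proof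
    fix x assume "x \<in> {x. norm (lat x) \<le> R}"
    then obtain m n where x: "x = (m, n)" "norm (lat (m, n)) \<le> R" by (cases x) auto
    then have "c * real_of_int (max \<bar>m\<bar> \<bar>n\<bar>) \<le> R" using c(2)[of m n] by linarith
    then have "real_of_int (max \<bar>m\<bar> \<bar>n\<bar>) \<le> R / c" using c(1) by (simp add: field_simps)
    then have "max \<bar>m\<bar> \<bar>n\<bar> \<le> N" unfolding N_def by (simp add: le_floor_iff)
    then show "x \<in> {-N..N} \<times> {-N..N}" using x by auto
  qed
  then show ?thesis using finite_subset by blast
qed

lemma lat_eq_0_iff [simp]: "lat x = 0 \<longleftrightarrow> x = 0"
proof
  assume *: "lat x = 0"
  obtain c where c: "c > 0" "\<And>m n. c * real_of_int (max \<bar>m\<bar> \<bar>n\<bar>) \<le> norm (lat (m, n))"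
    by (rule lat_norm_bound) blast
  obtain m n where x: "x = (m, n)" by (cases x)
  have "c * real_of_int (max \<bar>m\<bar> \<bar>n\<bar>) \<le> 0" using c(2)[of m n] * x by simp
  then have "max \<bar>m\<bar> \<bar>n\<bar> \<le> 0" using c(1) by (simp add: mult_le_0_iff)
  then have "\<bar>m\<bar> \<le> 0" "\<bar>n\<bar> \<le> 0" by simp_all
  then show "x = 0" by (simp add: x zero_prod_def)
qed simp

lemma lattice_sparse: "\<Lambda> sparse_in UNIV"
proof -
  have "\<not> z islimpt \<Lambda>" for z
  proof
    assume "z islimpt \<Lambda>"
    then have "infinite (ball z 1 \<inter> \<Lambda>)"
      using islimpt_eq_infinite_ball[of z \<Lambda>] by (simp add: Int_commute)
    moreover have "ball z 1 \<inter> \<Lambda> \<subseteq> lat ` {x. norm (lat x) \<le> norm z + 1}"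
    proof
      fix w assume "w \<in> ball z 1 \<inter> \<Lambda>"
      then obtain x where "w = lat x" "dist z w < 1" by (auto simp: lattice_eq_range)
      moreover from this have "norm w \<le> norm z + 1"
        using norm_triangle_ineq2[of w z] by (simp add: dist_norm norm_minus_commute)
      ultimately show "w \<in> lat ` {x. norm (lat x) \<le> norm z + 1}" by auto
    qed
    ultimately show False using finite_lat_bounded finite_subset by blast
  qed
  then show ?thesis by (simp add: sparse_in_open)
qed

end

lemma summable_int_powr:
  "(\<lambda>n::int. (1 + \<bar>real_of_int n\<bar>) powr (-3/2)) summable_on UNIV"
proof -
  let ?f = "\<lambda>n::int. (1 + \<bar>real_of_int n\<bar>) powr (-3/2)"
  have "summable (\<lambda>n. real n powr (-3/2))" by (simp add: summable_real_powr_iff)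
  then have "summable (\<lambda>n. real (Suc n) powr (-3/2))"
    using summable_Suc_iff[of "\<lambda>n. real n powr (-3/2)"] by simp
  then have nat: "(\<lambda>n. (1 + real n) powr (-3/2)) summable_on UNIV"
    by (intro norm_summable_imp_summable_on) (simp add: add.commute)
  have 1: "?f summable_on range int"
    by (subst summable_on_reindex) (use nat in \<open>auto simp: o_def\<close>)
  have 2: "?f summable_on range (\<lambda>n. - int n)"
    by (subst summable_on_reindex) (use nat in \<open>auto simp: o_def inj_on_def\<close>)
  have "(UNIV :: int set) = range int \<union> range (\<lambda>n. - int n)"
    by (metis (no_types, lifting) UNIV_eq_I UnI1 UnI2 int_cases2 rangeI)
  then show ?thesis using summable_on_union[OF 1 2] by simp
qed

context period_pair begin

lemma summable_lat_cube: "(\<lambda>x. 1 / norm (lat x) ^ 3) summable_on UNIV"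
proof -
  obtain c where c: "c > 0" "\<And>m n. c * real_of_int (max \<bar>m\<bar> \<bar>n\<bar>) \<le> norm (lat (m, n))"
    by (rule lat_norm_bound) blast
  let ?f = "\<lambda>n::int. (1 + \<bar>real_of_int n\<bar>) powr (-3/2)"
  have "(\<lambda>(m, n). ?f m * ?f n) summable_on UNIV \<times> UNIV"
  proof (rule summable_on_SigmaI)
    show "((\<lambda>n. case (m, n) of (m, n) \<Rightarrow> ?f m * ?f n) has_sum ?f m * infsum ?f UNIV) UNIV" for m
      using has_sum_cmult_right[OF has_sum_infsum[OF summable_int_powr], of "?f m"] by simp
    show "(\<lambda>m. ?f m * infsum ?f UNIV) summable_on UNIV"
      by (intro summable_on_cmult_left summable_int_powr)
  qed auto
  then have "(\<lambda>x. 8 / c ^ 3 * (?f (fst x) * ?f (snd x))) summable_on UNIV"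
    by (intro summable_on_cmult_right) (simp add: case_prod_unfold)
  then show ?thesis
  proof (rule summable_on_comparison_test)
    fix x :: "int \<times> int"
    obtain m n where x: "x = (m, n)" by (cases x)
    show "1 / norm (lat x) ^ 3 \<le> 8 / c ^ 3 * (?f (fst x) * ?f (snd x))"
    proof (cases "x = 0")
      case True
      then show ?thesis using c(1) by simp
    next
      case False
      define M where "M = real_of_int (max \<bar>m\<bar> \<bar>n\<bar>)"
      have M: "M \<ge> 1" using False x unfolding M_def by (auto simp: zero_prod_def)
      have "1 + \<bar>real_of_int m\<bar> \<le> 2 * M" "1 + \<bar>real_of_int n\<bar> \<le> 2 * M"
        using M unfolding M_def by auto
      (* Splitting M^3 evenly between the two coordinates gives a product of two convergent
         one-dimensional series. *)
      then have "(2 * M) powr (-3/2) \<le> ?f m" "(2 * M) powr (-3/2) \<le> ?f n"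
        by (intro powr_mono2' ; simp)+
      then have "(2 * M) powr (-3/2) * (2 * M) powr (-3/2) \<le> ?f m * ?f n"
        by (intro mult_mono) auto
      also have "(2 * M) powr (-3/2) * (2 * M) powr (-3/2) = (2 * M) powr (-3)"
        by (simp flip: powr_add)
      also have "\<dots> = 1 / (2 * M) ^ 3"
      proof -
        have "(2 * M) powr 3 = (2 * M) ^ 3" using M by (intro powr_numeral) auto
        then show ?thesis using powr_minus_divide[of "2 * M" 3] by (metis (no_types))
      qed
      finally have 1: "1 / (2 * M) ^ 3 \<le> ?f m * ?f n" .
      have "(c * M) ^ 3 \<le> norm (lat x) ^ 3"
        using c M unfolding x M_def by (intro power_mono) auto
      then have "1 / norm (lat x) ^ 3 \<le> 1 / (c * M) ^ 3"
        using c(1) M by (intro frac_le) auto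
      also have "\<dots> = 8 / c ^ 3 * (1 / (2 * M) ^ 3)" by (simp add: power_mult_distrib)
      also have "\<dots> \<le> 8 / c ^ 3 * (?f m * ?f n)" using 1 c(1) by (intro mult_left_mono) auto
      finally show ?thesis by (simp add: x)
    qed
  qed auto
qed

text \<open>Since 1/0 = 0, the summand 1/z^2 is the term of index 0, so that P is a single sum over the
  whole index group. Shifting and negating the index then need no case distinction.\<close>

definition wp_term :: "complex \<Rightarrow> int \<times> int \<Rightarrow> complex" where
  "wp_term z x = 1 / (z + lat x)\<^sup>2 - 1 / (lat x)\<^sup>2"

lemma wp_term_bound:
  assumes "norm z \<le> R" "norm (lat x) \<ge> 2 * R" "R > 0"
  shows "norm (wp_term z x) \<le> 10 * R * (1 / norm (lat x) ^ 3)"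
proof -
  define l where "l = lat x"
  have l: "norm l \<ge> 2 * R" "norm l > 0" "l \<noteq> 0" using assms by (auto simp: l_def)
  have zl: "norm (z + l) \<ge> norm l / 2"
    using norm_triangle_ineq2[of l "-z"] assms l by (simp add: add.commute)
  then have nz: "z + l \<noteq> 0" using l by auto
  have "wp_term z x = - (z * (2 * l + z)) / (l\<^sup>2 * (z + l)\<^sup>2)"
    using l nz unfolding wp_term_def l_def[symmetric]
    by (simp add: divide_simps) (simp add: algebra_simps power2_eq_square)
  then have "norm (wp_term z x) = norm z * norm (2 * l + z) / (norm l ^ 2 * norm (z + l) ^ 2)"
    by (simp add: norm_divide norm_mult norm_power)
  also have "\<dots> \<le> R * (5 / 2 * norm l) / (norm l ^ 2 * (norm l / 2) ^ 2)"
  proof (rule frac_le)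
    have "norm (2 * l + z) \<le> 5 / 2 * norm l"
      using norm_triangle_ineq[of "2 * l" z] assms l by (simp add: norm_mult)
    then show "norm z * norm (2 * l + z) \<le> R * (5 / 2 * norm l)"
      using assms by (intro mult_mono) auto
    show "norm l ^ 2 * (norm l / 2) ^ 2 \<le> norm l ^ 2 * norm (z + l) ^ 2"
      using zl by (intro mult_left_mono power_mono) auto
  qed (use l assms in auto)
  also have "\<dots> = 10 * R * (1 / norm l ^ 3)"
    using l by (simp add: field_simps power2_eq_square power3_eq_cube)
  finally show ?thesis by (simp add: l_def)
qed

lemma wp_term_summable: "wp_term z summable_on UNIV"
proof -
  define R where "R = norm z + 1"
  let ?S = "{x. norm (lat x) \<le> 2 * R}"
  have "wp_term z summable_on - ?S"
  proof (rule abs_summable_summable)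
    show "(\<lambda>x. norm (wp_term z x)) summable_on - ?S"
    proof (rule summable_on_comparison_test)
      show "(\<lambda>x. 10 * R * (1 / norm (lat x) ^ 3)) summable_on - ?S"
        by (intro summable_on_cmult_right summable_on_subset_banach[OF summable_lat_cube]) auto
    qed (use wp_term_bound[of z R] in \<open>auto simp: R_def add_nonneg_pos\<close>)
  qed
  moreover have "wp_term z summable_on ?S" by (intro summable_on_finite finite_lat_bounded)
  ultimately have "wp_term z summable_on (?S \<union> - ?S)" by (intro summable_on_union)
  then show ?thesis by simp
qed

lemma wp_eq_infsum: "P z = (\<Sum>\<^sub>\<infinity>x. wp_term z x)"
proof -
  have set: "{(m :: int, n :: int). m\<^sup>2 + n\<^sup>2 \<noteq> 0} = - {0}"
    by (auto simp: zero_prod_def sum_power2_eq_zero_iff)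
  have "P z = 1 / z\<^sup>2 + (\<Sum>\<^sub>\<infinity>x\<in>-{0}. wp_term z x)"
    unfolding weierstrass_p_def set
    by (intro arg_cong2[of _ _ _ _ "(+)"] refl infsum_cong)
       (auto simp: wp_term_def lat_def add.assoc)
  also have "1 / z\<^sup>2 = (\<Sum>\<^sub>\<infinity>x\<in>{0}. wp_term z x)" by (simp add: wp_term_def)
  also have "\<dots> + (\<Sum>\<^sub>\<infinity>x\<in>-{0}. wp_term z x) = (\<Sum>\<^sub>\<infinity>x\<in>{0} \<union> -{0}. wp_term z x)"
    by (intro infsum_Un_disjoint[symmetric] summable_on_subset_banach[OF wp_term_summable]) auto
  finally show ?thesis by simp
qed

lemma wp_has_sum: "(wp_term z has_sum P z) UNIV"
  unfolding wp_eq_infsum by (intro has_sum_infsum wp_term_summable)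

lemma wp_even: "P (- z) = P z"
proof -
  have "((\<lambda>x. wp_term (- z) (- x)) has_sum P (- z)) UNIV"
    using has_sum_reindex_bij_betw[of uminus UNIV UNIV "wp_term (- z)" "P (- z)"] wp_has_sum
    by (simp add: bij_uminus)
  moreover have "wp_term (- z) (- x) = wp_term z x" for x
    by (simp add: wp_term_def lat_uminus power2_commute[of "- z" "lat x"] add.commute)
  ultimately show ?thesis using wp_has_sum[of z] has_sum_unique by simp
qed

text \<open>Shifting the summation index shows that P(z + \<omega>) - P(z) is a sum in which z no
  longer occurs. It is a constant, and evenness identifies it as 0.\<close>

lemma wp_periodic_lat: "P (z + lat y) = P z"
proof -
  have "P (z + lat y) - P z = (\<Sum>\<^sub>\<infinity>x. 1 / (lat (x + y))\<^sup>2 - 1 / (lat x)\<^sup>2)" for z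
  proof -
    have bij: "bij (\<lambda>x. x + y)"
      by (rule bij_plus_right)
    have "((\<lambda>x. wp_term z (x + y)) has_sum P z) UNIV"
      using has_sum_reindex_bij_betw[OF bij, of "wp_term z" "P z"] wp_has_sum by simp
    with wp_has_sum[of "z + lat y"]
    have "((\<lambda>x. wp_term (z + lat y) x - wp_term z (x + y)) has_sum (P (z + lat y) - P z)) UNIV"
      using has_sum_add[where g = "\<lambda>x. - wp_term z (x + y)" and b = "- P z"]
      by (simp add: has_sum_uminus)
    moreover have "wp_term (z + lat y) x - wp_term z (x + y) = 1 / (lat (x + y))\<^sup>2 - 1 / (lat x)\<^sup>2" for x
      by (simp add: wp_term_def lat_add add_ac)
    ultimately show ?thesis by (simp add: infsumI)
  qed
  (* The difference does not depend on z, and at the half period it vanishes by evenness. *)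
  from this[of z] this[of "- lat y / 2"]
  have "P (z + lat y) - P z = P (- lat y / 2 + lat y) - P (- lat y / 2)" by simp
  also have "- lat y / 2 + lat y = - (- lat y / 2)" by (simp add: field_simps)
  also have "P (- (- lat y / 2)) - P (- lat y / 2) = 0" by (subst wp_even) simp
  finally show ?thesis by simp
qed

lemma wp_periodic: "\<tau> \<in> \<Lambda> \<Longrightarrow> P (z + \<tau>) = P z"
  unfolding lattice_eq_range using wp_periodic_lat by auto

text \<open>On the disc of radius R only the finitely many terms with a pole near the disc are singular;
  the others converge uniformly by the Weierstrass test.\<close>

lemma wp_decompose:
  fixes R
  assumes R: "R > 0"
  defines "S \<equiv> {x. norm (lat x) \<le> 2 * R}"
  obtains H where "H holomorphic_on ball 0 R" "\<And>z. P z = (\<Sum>x\<in>S. wp_term z x) + H z"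
proof -
  define H where "H = (\<lambda>z. \<Sum>\<^sub>\<infinity>x\<in>-S. wp_term z x)"
  have fin: "finite S" unfolding S_def by (rule finite_lat_bounded)
  have "P z = (\<Sum>x\<in>S. wp_term z x) + H z" for z
  proof -
    have "P z = (\<Sum>\<^sub>\<infinity>x\<in>S \<union> - S. wp_term z x)" by (simp add: wp_eq_infsum)
    also have "\<dots> = (\<Sum>\<^sub>\<infinity>x\<in>S. wp_term z x) + H z" unfolding H_def
      by (intro infsum_Un_disjoint summable_on_subset_banach[OF wp_term_summable]) auto
    finally show ?thesis using fin by simp
  qed
  moreover have "H holomorphic_on ball 0 R"
  proof (rule holomorphic_uniform_limit)
    show "uniform_limit (cball 0 R) (\<lambda>X z. \<Sum>x\<in>X. wp_term z x) H (finite_subsets_at_top (- S))"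
      unfolding H_def
    proof (rule Weierstrass_m_test_general)
      show "(\<lambda>x. 10 * R * (1 / norm (lat x) ^ 3)) summable_on - S"
        by (intro summable_on_cmult_right summable_on_subset_banach[OF summable_lat_cube]) auto
    qed (use wp_term_bound R in \<open>auto simp: S_def\<close>)
    have hol: "(\<lambda>z. wp_term z x) holomorphic_on cball 0 R" if "x \<notin> S" for x
      unfolding wp_term_def
    proof -
      have "z + lat x \<noteq> 0" if "z \<in> cball 0 R" for z
        using that \<open>x \<notin> S\<close> R norm_triangle_ineq2[of "lat x" "-z"]
        by (auto simp: S_def add_eq_0_iff2)
      moreover have "lat x \<noteq> 0" using that R by (auto simp: S_def simp del: lat_eq_0_iff)
      ultimately show "(\<lambda>z. 1 / (z + lat x)\<^sup>2 - 1 / (lat x)\<^sup>2) holomorphic_on cball 0 R"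
        by (intro holomorphic_intros) auto
    qed
    show "\<forall>\<^sub>F X in finite_subsets_at_top (- S). continuous_on (cball 0 R) (\<lambda>z. \<Sum>x\<in>X. wp_term z x) \<and>
            (\<lambda>z. \<Sum>x\<in>X. wp_term z x) holomorphic_on ball 0 R"
    proof (rule eventually_finite_subsets_at_top_weakI)
      fix X assume X: "finite X" "X \<subseteq> - S"
      have "(\<lambda>z. \<Sum>x\<in>X. wp_term z x) holomorphic_on cball 0 R"
        using X by (intro holomorphic_on_sum hol) auto
      then show "continuous_on (cball 0 R) (\<lambda>z. \<Sum>x\<in>X. wp_term z x) \<and>
            (\<lambda>z. \<Sum>x\<in>X. wp_term z x) holomorphic_on ball 0 R"
        using holomorphic_on_imp_continuous_on holomorphic_on_subset ball_subset_cball by blast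
    qed
  qed auto
  ultimately show ?thesis using that by blast
qed

lemma wp_holomorphic: "P holomorphic_on - \<Lambda>"
proof -
  have op: "open (- \<Lambda>)" using lattice_sparse sparse_in_UNIV_imp_closed by blast
  have "P field_differentiable (at z)" if z: "z \<notin> \<Lambda>" for z
  proof -
    define R where "R = norm z + 1"
    have R: "R > 0" by (simp add: R_def add_nonneg_pos)
    obtain H where H: "H holomorphic_on ball 0 R" 
      "\<And>z. P z = (\<Sum>x | norm (lat x) \<le> 2 * R. wp_term z x) + H z"
      using wp_decompose[OF R] by blast
    have H': "H holomorphic_on ball 0 R - \<Lambda>" using H(1) holomorphic_on_subset by blast
    have "(\<lambda>z. (\<Sum>x | norm (lat x) \<le> 2 * R. wp_term z x) + H z) holomorphic_on (ball 0 R - \<Lambda>)"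
      unfolding wp_term_def divide_inverse
    proof (intro holomorphic_intros H')
      fix x z assume "z \<in> ball 0 R - \<Lambda>"
      then show "(z + lat x)\<^sup>2 \<noteq> 0"
        using lattice_uminus_iff[of "lat x"] by (auto simp: lattice_eq_range add_eq_0_iff2)
    qed
    then have "P holomorphic_on (ball 0 R - \<Lambda>)" using H(2) by presburger
    moreover have "open (ball 0 R - \<Lambda>)" using op by (simp add: Diff_eq open_Int)
    moreover have "z \<in> ball 0 R - \<Lambda>" using z by (simp add: R_def)
    ultimately show ?thesis using holomorphic_on_imp_differentiable_at by blast
  qed
  then show ?thesis using op by (auto simp: holomorphic_on_open field_differentiable_def)
qed

lemma wp_analytic: "z \<notin> \<Lambda> \<Longrightarrow> P analytic_on {z}"
  using wp_holomorphic lattice_sparse sparse_in_UNIV_imp_closed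
  by (auto simp: analytic_at intro!: exI[of _ "- \<Lambda>"])

lemma wp_pole: assumes "\<tau> \<in> \<Lambda>" shows "is_pole P \<tau>"
proof -
  obtain H where H: "H holomorphic_on ball 0 1" 
      "\<And>z. P z = (\<Sum>x | norm (lat x) \<le> 2 * 1. wp_term z x) + H z"
    using wp_decompose[of 1] by auto
  define S where "S = {x. norm (lat x) \<le> 2 * 1}"
  have fin: "finite S" unfolding S_def by (rule finite_lat_bounded)
  have 0: "0 \<in> S" by (simp add: S_def)
  define G where "G = (\<lambda>z. (\<Sum>x\<in>S - {0}. wp_term z x) + H z)"
  (* The term of index 0 is 1 / z^2, because 1 / 0 = 0. *)
  have "P z = 1 / z\<^sup>2 + G z" for z
    unfolding H(2) G_def S_def[symmetric] using sum.remove[OF fin 0, of "wp_term z"]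
    by (simp add: wp_term_def)
  have "isCont G 0"
  proof -
    have "isCont H 0" using H(1) holomorphic_on_imp_continuous_on[OF H(1)]
      by (simp add: continuous_on_eq_continuous_at)
    then show ?thesis unfolding G_def wp_term_def by (intro continuous_intros) auto
  qed
  then have G: "G \<midarrow>0\<rightarrow> G 0" by (rule isContD)
  have "filterlim (\<lambda>z::complex. 1 / z\<^sup>2) at_infinity (at 0)"
    using is_pole_inverse_power[of 2 "0::complex"] by (simp add: is_pole_def)
  then have "filterlim (\<lambda>z. 1 / z\<^sup>2 + G z) at_infinity (at 0)"
    using tendsto_add_filterlim_at_infinity'[OF _ G] by blast
  then have "is_pole P 0" using \<open>\<And>z. P z = 1 / z\<^sup>2 + G z\<close> by (simp add: is_pole_def)
  moreover have "is_pole P \<tau> \<longleftrightarrow> is_pole (\<lambda>z. P (\<tau> + z)) 0"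
    using is_pole_shift_0[of P \<tau>] by (simp add: add.commute)
  ultimately show ?thesis using assms by (simp add: wp_periodic add.commute[of \<tau>])
qed

lemma wp_meromorphic: "P meromorphic_on UNIV"
proof (rule meromorphic_onI_open[where pts = \<Lambda>])
  show "P analytic_on UNIV - \<Lambda>"
    using wp_analytic analytic_on_analytic_at by blast
  show "not_essential P z" if "z \<in> \<Lambda>" for z
    using wp_pole[OF that] by (simp add: not_essential_def)
  show "\<not> z islimpt \<Lambda> \<inter> UNIV" for z using lattice_sparse by (simp add: sparse_in_open)
qed auto

lemma deriv_wp_periodic: "\<tau> \<in> \<Lambda> \<Longrightarrow> deriv P (z + \<tau>) = deriv P z"
  using deriv_shift_0[where f=P and z="z + \<tau>"] deriv_shift_0[where f=P and z=z] wp_periodic[of \<tau> "z + _"]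
  by (simp add: o_def add_ac)

lemma deriv_wp_odd: assumes "z \<notin> \<Lambda>" shows "deriv P (- z) = - deriv P z"
proof -
  have "((\<lambda>z. P (- z)) has_field_derivative deriv P (- z) * (- 1)) (at z)"
    by (rule DERIV_chain2[where f = P and g = uminus])
      (use assms wp_analytic[of "-z"] in \<open>auto intro!: analytic_derivI derivative_eq_intros\<close>)
  then have "deriv (\<lambda>z. P (- z)) z = deriv P (- z) * (- 1)" by (rule DERIV_imp_deriv)
  then show ?thesis by (simp add: wp_even)
qed

end

section \<open>The equianharmonic case\<close>

text \<open>The invariants are g2 = 0 and g3 = 1. The first makes the lattice invariant under
  multiplication by cube roots of unity (lattice_rotate).\<close>

locale equianharmonic = period_pair +
  fixes \<theta>\<^sub>1 \<theta>\<^sub>2 :: complex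
  assumes ode: "z \<notin> \<Lambda> \<Longrightarrow> (deriv P z)\<^sup>2 = 4 * P z ^ 3 - 1"
    and th1: "\<theta>\<^sub>1 \<notin> \<Lambda>" "P \<theta>\<^sub>1 = 0" "deriv P \<theta>\<^sub>1 = - \<i>"
    and th2: "\<theta>\<^sub>2 \<notin> \<Lambda>" "P \<theta>\<^sub>2 = 0" "deriv P \<theta>\<^sub>2 = \<i>"
begin

lemma off_lattice: "\<forall>\<^sub>\<approx>z\<in>UNIV. z \<notin> \<Lambda>"
  by (rule eventually_not_in_cosparse[OF lattice_sparse])

lemma off_lattice_nhds: "z \<notin> \<Lambda> \<Longrightarrow> \<forall>\<^sub>F w in nhds z. w \<notin> \<Lambda>"
  using eventually_nhds_in_open[of "- \<Lambda>" z] lattice_sparse sparse_in_UNIV_imp_closed by auto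

lemma wp_deriv: "z \<notin> \<Lambda> \<Longrightarrow> (P has_field_derivative deriv P z) (at z)"
  using wp_analytic analytic_derivI by blast

lemma deriv_wp_analytic: "z \<notin> \<Lambda> \<Longrightarrow> deriv P analytic_on {z}"
  using wp_analytic by (rule analytic_deriv)

lemma wp_nonzero: "\<forall>\<^sub>\<approx>z\<in>UNIV. P z \<noteq> 0"
proof -
  have "\<not> (\<forall>\<^sub>\<approx>z\<in>UNIV. P z = 0)"
  proof
    assume "\<forall>\<^sub>\<approx>z\<in>UNIV. P z = 0"
    then have "\<forall>\<^sub>F z in at 0. P z = 0" using eventually_cosparse_imp_eventually_at by blast
    moreover have "\<forall>\<^sub>F z in at 0. P z \<noteq> 0" by (intro non_zero_neighbour_pole wp_pole) auto
    ultimately have "\<forall>\<^sub>F z::complex in at 0. False" by eventually_elim simp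
    then show False by simp
  qed
  then show ?thesis using meromorphic_imp_constant_or_avoid[OF wp_meromorphic, of 0] by auto
qed

lemma deriv_wp_nonzero: "\<forall>\<^sub>\<approx>z\<in>UNIV. deriv P z \<noteq> 0"
proof -
  have "deriv P meromorphic_on UNIV" by (intro meromorphic_intros wp_meromorphic)
  from meromorphic_imp_constant_or_avoid[OF this, of 0]
  have "(\<forall>\<^sub>\<approx>z\<in>UNIV. deriv P z = 0) \<or> (\<forall>\<^sub>\<approx>z\<in>UNIV. deriv P z \<noteq> 0)" by auto
  moreover have "\<not> (\<forall>\<^sub>\<approx>z\<in>UNIV. deriv P z = 0)"
  proof
    assume "\<forall>\<^sub>\<approx>z\<in>UNIV. deriv P z = 0"
    then have "\<forall>\<^sub>F z in at \<theta>\<^sub>1. deriv P z = 0" using eventually_cosparse_imp_eventually_at by blast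
    then have "deriv P \<midarrow>\<theta>\<^sub>1\<rightarrow> 0" by (rule tendsto_eventually)
    moreover have "deriv P \<midarrow>\<theta>\<^sub>1\<rightarrow> deriv P \<theta>\<^sub>1"
      using analytic_at_imp_isCont[OF deriv_wp_analytic[OF th1(1)]] by (rule isContD)
    ultimately have "deriv P \<theta>\<^sub>1 = 0" by (rule LIM_unique[rotated])
    then show False using th1 by simp
  qed
  ultimately show ?thesis by blast
qed

text \<open>Obtained by differentiating P'^2 = 4 P^3 - 1 and cancelling P'.\<close>

lemma wp_deriv2:
  assumes z: "z \<notin> \<Lambda>" "deriv P z \<noteq> 0"
  shows "(deriv P has_field_derivative 6 * P z ^ 2) (at z)"
proof -
  have d: "(deriv P has_field_derivative deriv (deriv P) z) (at z)"
    using deriv_wp_analytic[OF z(1)] by (rule analytic_derivI)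
  have 1: "((\<lambda>z. (deriv P z)\<^sup>2) has_field_derivative 2 * deriv P z * deriv (deriv P) z) (at z)"
    using DERIV_power[OF d, of 2] by (simp add: algebra_simps)
  have 2: "((\<lambda>z. 4 * P z ^ 3 - 1) has_field_derivative 12 * P z ^ 2 * deriv P z) (at z)"
    using DERIV_diff[OF DERIV_cmult[OF DERIV_power[OF wp_deriv[OF z(1)], of 3], of 4] DERIV_const[of 1]]
    by (simp add: algebra_simps)
  have "\<forall>\<^sub>F w in nhds z. (deriv P w)\<^sup>2 = 4 * P w ^ 3 - 1"
    using off_lattice_nhds[OF z(1)] by eventually_elim (rule ode)
  then have "deriv (\<lambda>z. (deriv P z)\<^sup>2) z = deriv (\<lambda>z. 4 * P z ^ 3 - 1) z"
    by (intro deriv_cong_ev) auto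
  then have "2 * deriv P z * deriv (deriv P) z = 12 * P z ^ 2 * deriv P z"
    using DERIV_imp_deriv[OF 1] DERIV_imp_deriv[OF 2] by simp
  then have "deriv (deriv P) z = 6 * P z ^ 2" using z(2) by simp
  with d show ?thesis by simp
qed

text \<open>The source of all symmetries. The functions P(a + z) and \<rho>^2 P(b + \<rho> z) solve the same
  equation u'^2 = 4 u^3 - 1 with the same initial data, so they coincide; comparing their poles
  shows that the affine map z -> b + \<rho> (z - a) sends periods to periods.
  The three uses are: the zeros of P modulo periods (\<rho> = 1), the rotations
  (a = b), and \<theta>1 + \<theta>2 being a period (a = - \<theta>1, b = \<theta>2).\<close>

lemma wp_rotation:
  assumes a: "a \<notin> \<Lambda>" and b: "b \<notin> \<Lambda>" and \<rho>: "\<rho> ^ 3 = 1"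
    and init: "P b = \<rho> * P a" "deriv P b = deriv P a" "deriv P a \<noteq> 0"
  shows "b - \<rho> * a \<in> \<Lambda>" and "\<And>\<tau>. \<tau> \<in> \<Lambda> \<Longrightarrow> \<rho> * \<tau> \<in> \<Lambda>"
    and "\<forall>\<^sub>\<approx>z\<in>UNIV. P (\<rho> * z) = \<rho> * P z"
proof -
  define u where "u = (\<lambda>z. P (a + z))"
  define v where "v = (\<lambda>z. \<rho> ^ 2 * P (b + \<rho> * z))"
  have du: "(u has_field_derivative deriv P (a + z)) (at z)" if "a + z \<notin> \<Lambda>" for z
  proof -
    have "((\<lambda>z. a + z) has_field_derivative 1) (at z)"
      using DERIV_add[OF DERIV_const DERIV_ident] by simp
    from DERIV_chain2[OF wp_deriv[OF that] this] show ?thesis by (simp add: u_def)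
  qed
  have dv: "(v has_field_derivative deriv P (b + \<rho> * z)) (at z)" if "b + \<rho> * z \<notin> \<Lambda>" for z
  proof -
    have "((\<lambda>z. b + \<rho> * z) has_field_derivative \<rho>) (at z)"
      using DERIV_add[OF DERIV_const DERIV_cmult[OF DERIV_ident]] by simp
    from DERIV_cmult[OF DERIV_chain2[OF wp_deriv[OF that] this], of "\<rho> ^ 2"]
    have "(v has_field_derivative \<rho> ^ 3 * deriv P (b + \<rho> * z)) (at z)"
      by (simp add: v_def power2_eq_square power3_eq_cube mult_ac)
    then show ?thesis by (simp add: \<rho>)
  qed
  have "open ((\<lambda>z. b + \<rho> * z) -` (- \<Lambda>))" "open ((\<lambda>z. a + z) -` (- \<Lambda>))"
    using lattice_sparse sparse_in_UNIV_imp_closed 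
    by (intro continuous_open_vimage continuous_intros; auto)+
  note op = this
  have va: "v analytic_on {z}" if "b + \<rho> * z \<notin> \<Lambda>" for z
    unfolding analytic_at using that dv op(1)
    by (intro exI[of _ "(\<lambda>z. b + \<rho> * z) -` (- \<Lambda>)"]) (auto simp: holomorphic_on_open)
  have ua: "u analytic_on {z}" if "a + z \<notin> \<Lambda>" for z
    unfolding analytic_at using that du op(2)
    by (intro exI[of _ "(\<lambda>z. a + z) -` (- \<Lambda>)"]) (auto simp: holomorphic_on_open)
  have evu: "\<forall>\<^sub>F z in nhds 0. a + z \<notin> \<Lambda>"
    using eventually_nhds_in_open[OF op(2), of 0] a by simp
  have evv: "\<forall>\<^sub>F z in nhds 0. b + \<rho> * z \<notin> \<Lambda>"
    using eventually_nhds_in_open[OF op(1), of 0] b by simp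
  have ev: "\<forall>\<^sub>F z in nhds 0. u z = v z"
  proof (rule ode_unique[where n = 2 and R = "\<lambda>y. 4 * y ^ 3 - 1"])
    show "u analytic_on {0}" "v analytic_on {0}" using ua[of 0] va[of 0] a b by auto
    have "v 0 = \<rho> ^ 3 * P a" by (simp add: v_def init(1) power2_eq_square power3_eq_cube)
    then show "u 0 = v 0" by (simp add: u_def \<rho>)
    show "deriv u 0 = deriv v 0" "deriv v 0 \<noteq> 0"
      using DERIV_imp_deriv[OF du[of 0]] DERIV_imp_deriv[OF dv[of 0]] a b init by auto
    show "\<forall>\<^sub>F z in nhds 0. deriv u z ^ 2 = 4 * u z ^ 3 - 1"
      using evu by eventually_elim (use DERIV_imp_deriv[OF du] ode in \<open>auto simp: u_def\<close>)
    show "\<forall>\<^sub>F z in nhds 0. deriv v z ^ 2 = 4 * v z ^ 3 - 1"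
      using evv
    proof eventually_elim
      case (elim z)
      have "(\<rho>\<^sup>2) ^ 3 = (\<rho> ^ 3) ^ 2" by (simp flip: power_mult)
      then show ?case using DERIV_imp_deriv[OF dv[OF elim]] ode[OF elim] \<rho>
        by (simp add: v_def power_mult_distrib)
    qed
  qed auto
  have um: "u meromorphic_on UNIV" unfolding u_def
    by (intro mero_compose_entire[OF wp_meromorphic] holomorphic_intros)
  have vm: "v meromorphic_on UNIV" unfolding v_def
    by (intro meromorphic_intros mero_compose_entire[OF wp_meromorphic] holomorphic_intros)
  have uv: "mero_eq u v" by (rule mero_eq_identity[OF um vm ev])
  (* Equal meromorphic functions have the same poles, and the poles of both sides are known. *)
  have key: "b + \<rho> * z \<in> \<Lambda>" if "a + z \<in> \<Lambda>" for z
  proof (rule ccontr)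
    assume "b + \<rho> * z \<notin> \<Lambda>"
    then have "\<not> is_pole v z" using va analytic_at_imp_no_pole by blast
    moreover have "is_pole u z"
    proof -
      have "is_pole (P \<circ> (+) a) z"
        using is_pole_shift_iff[of P a z] wp_pole[OF that] by (simp add: add.commute)
      then show ?thesis by (simp add: u_def o_def)
    qed
    moreover have "\<forall>\<^sub>F w in at z. u w = v w"
      using uv eventually_cosparse_imp_eventually_at unfolding mero_eq_def by blast
    ultimately show False using is_pole_cong[of u v z z] by blast
  qed
  (* The pole of the left-hand side coming from 0, then those coming from the other periods. *)
  show b1: "b - \<rho> * a \<in> \<Lambda>" using key[of "- a"] by simp
  show "\<rho> * \<tau> \<in> \<Lambda>" if "\<tau> \<in> \<Lambda>" for \<tau>
  proof -
    have "b + \<rho> * (\<tau> - a) \<in> \<Lambda>" using key[of "\<tau> - a"] that by simp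
    also have "b + \<rho> * (\<tau> - a) = \<rho> * \<tau> + (b - \<rho> * a)" by (simp add: algebra_simps)
    finally show ?thesis using b1 lattice_add_right_iff by blast
  qed
  have "\<forall>\<^sub>\<approx>z\<in>UNIV. u (1 * z + - a) = v (1 * z + - a)"
    using uv unfolding mero_eq_def by (rule cosparse_affine) auto
  then show "\<forall>\<^sub>\<approx>z\<in>UNIV. P (\<rho> * z) = \<rho> * P z"
  proof eventually_elim
    case (elim z)
    have "b + \<rho> * (z - a) = \<rho> * z + (b - \<rho> * a)" by (simp add: algebra_simps)
    then have "P (b + \<rho> * (z - a)) = P (\<rho> * z + (b - \<rho> * a))" by (rule arg_cong)
    also have "\<dots> = P (\<rho> * z)" by (rule wp_periodic[OF b1])
    finally have "P (b + \<rho> * (z - a)) = P (\<rho> * z)" .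
    then have "P z = \<rho> ^ 2 * P (\<rho> * z)" using elim by (simp add: u_def v_def)
    then have "\<rho> * P z = \<rho> ^ 3 * P (\<rho> * z)" by (simp add: power2_eq_square power3_eq_cube)
    then show ?case using \<rho> by simp
  qed
qed

lemma wp_zeros:
  assumes "c \<notin> \<Lambda>" "P c = 0"
  shows "c - \<theta>\<^sub>1 \<in> \<Lambda> \<or> c - \<theta>\<^sub>2 \<in> \<Lambda>"
proof -
  have "(deriv P c)\<^sup>2 = \<i>\<^sup>2" using ode[OF assms(1)] assms(2) by simp
  then have "deriv P c = \<i> \<or> deriv P c = - \<i>" unfolding power2_eq_iff by blast
  then show ?thesis
    using wp_rotation(1)[OF th1(1) assms(1), of 1] wp_rotation(1)[OF th2(1) assms(1), of 1]
      th1 th2 assms by auto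
qed

lemma zeros_sum_in_lattice: "\<theta>\<^sub>1 + \<theta>\<^sub>2 \<in> \<Lambda>"
  using wp_rotation(1)[of "- \<theta>\<^sub>1" "\<theta>\<^sub>2" 1] th1 th2 wp_even[of \<theta>\<^sub>1] deriv_wp_odd[OF th1(1)]
  by (simp add: add.commute)

lemma lattice_rotate: "\<rho> ^ 3 = 1 \<Longrightarrow> \<tau> \<in> \<Lambda> \<Longrightarrow> \<rho> * \<tau> \<in> \<Lambda>"
  using wp_rotation(2)[OF th1(1) th1(1), of \<rho> \<tau>] th1 by simp

lemma zero_rotate: "\<rho> ^ 3 = 1 \<Longrightarrow> \<theta>\<^sub>1 - \<rho> * \<theta>\<^sub>1 \<in> \<Lambda>"
  using wp_rotation(1)[OF th1(1) th1(1), of \<rho>] th1 by simp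

lemma wp_rotate: "\<rho> ^ 3 = 1 \<Longrightarrow> \<forall>\<^sub>\<approx>z\<in>UNIV. P (\<rho> * z) = \<rho> * P z"
  using wp_rotation(3)[OF th1(1) th1(1), of \<rho>] th1 by simp

lemma three_zero_in_lattice: "3 * \<theta>\<^sub>1 \<in> \<Lambda>"
proof -
  define \<zeta> where "\<zeta> = Complex (- 1 / 2) (sqrt 3 / 2)"
  have sq: "\<zeta>\<^sup>2 = - 1 - \<zeta>"
    by (simp add: \<zeta>_def complex_eq_iff power2_eq_square)
  have "\<zeta> ^ 3 = \<zeta> * \<zeta>\<^sup>2" by (simp add: power2_eq_square power3_eq_cube)
  also have "\<dots> = - \<zeta> - \<zeta>\<^sup>2" by (simp add: sq algebra_simps flip: power2_eq_square)
  finally have z3: "\<zeta> ^ 3 = 1" by (simp add: sq)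
  have "\<theta>\<^sub>1 - \<zeta> * \<theta>\<^sub>1 \<in> \<Lambda>" by (rule zero_rotate[OF z3])
  moreover have "\<zeta>\<^sup>2 * (\<theta>\<^sub>1 - \<zeta> * \<theta>\<^sub>1) \<in> \<Lambda>"
  proof (rule lattice_rotate)
    have "(\<zeta>\<^sup>2) ^ 3 = (\<zeta> ^ 3)\<^sup>2" by (simp flip: power_mult)
    then show "(\<zeta>\<^sup>2) ^ 3 = 1" by (simp add: z3)
  qed fact
  ultimately have "(\<theta>\<^sub>1 - \<zeta> * \<theta>\<^sub>1) - \<zeta>\<^sup>2 * (\<theta>\<^sub>1 - \<zeta> * \<theta>\<^sub>1) \<in> \<Lambda>" by (rule lattice_diff)
  (* For the primitive cube root of unity \<zeta>, (1 - \<zeta>) (1 - \<zeta>^2) = 3. *)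
  also have "(\<theta>\<^sub>1 - \<zeta> * \<theta>\<^sub>1) - \<zeta>\<^sup>2 * (\<theta>\<^sub>1 - \<zeta> * \<theta>\<^sub>1) = (1 - \<zeta> - \<zeta>\<^sup>2 + \<zeta> ^ 3) * \<theta>\<^sub>1"
    by (simp add: algebra_simps power2_eq_square power3_eq_cube)
  also have "1 - \<zeta> - \<zeta>\<^sup>2 + \<zeta> ^ 3 = 3" unfolding z3 sq by simp
  finally show ?thesis .
qed

lemma deriv_wp_rotate:
  assumes \<rho>: "\<rho> ^ 3 = 1"
  shows "\<forall>\<^sub>\<approx>z\<in>UNIV. deriv P (\<rho> * z) = deriv P z"
proof -
  have \<rho>0: "\<rho> \<noteq> 0" using \<rho> by auto
  have "\<forall>\<^sub>\<approx>z\<in>UNIV. \<rho> * z + 0 \<notin> \<Lambda>" by (rule cosparse_affine[OF off_lattice \<rho>0])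
  with cosparse_eventually_nhds[OF wp_rotate[OF \<rho>]] off_lattice
  show ?thesis
  proof eventually_elim
    case (elim z)
    have "((*) \<rho> has_field_derivative \<rho>) (at z)" using DERIV_cmult[OF DERIV_ident, of \<rho> z] by simp
    moreover have "(P has_field_derivative deriv P (\<rho> * z)) (at (\<rho> * z))" using elim(3) wp_deriv by simp
    ultimately have "((\<lambda>z. P (\<rho> * z)) has_field_derivative deriv P (\<rho> * z) * \<rho>) (at z)"
      by (intro DERIV_chain2)
    moreover have "((\<lambda>z. \<rho> * P z) has_field_derivative \<rho> * deriv P z) (at z)"
      using DERIV_cmult[OF wp_deriv[OF elim(2)]] .
    moreover have "deriv (\<lambda>z. P (\<rho> * z)) z = deriv (\<lambda>z. \<rho> * P z) z"
      using elim(1) by (intro deriv_cong_ev) auto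
    ultimately have "deriv P (\<rho> * z) * \<rho> = \<rho> * deriv P z" using DERIV_imp_deriv by metis
    then show ?case using \<rho>0 by simp
  qed
qed

section \<open>Parametrisation of the Fermat cubic\<close>

definition fermat_x :: "complex \<Rightarrow> complex" where
  "fermat_x w = (1/2) * (1 + deriv P w / of_real (sqrt 3)) / P w"

definition fermat_y :: "complex \<Rightarrow> complex" where
  "fermat_y w = (1/2) * (1 - deriv P w / of_real (sqrt 3)) / P w"

lemma sqrt3_sq: "(complex_of_real (sqrt 3))\<^sup>2 = 3"
  by (simp flip: of_real_power)

lemma fermat_cubes:
  assumes "w \<notin> \<Lambda>" "P w \<noteq> 0"
  shows "fermat_x w ^ 3 + fermat_y w ^ 3 = 1"
proof -
  define a where "a = deriv P w / of_real (sqrt 3)"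
  have a2: "3 * a ^ 2 = 4 * P w ^ 3 - 1"
    using ode[OF assms(1)] sqrt3_sq by (simp add: a_def power_divide)
  have "(1 + a) ^ 3 + (1 - a) ^ 3 = 2 + 2 * (3 * a ^ 2)"
    by (simp add: power2_eq_square power3_eq_cube algebra_simps)
  also have "\<dots> = 8 * P w ^ 3" by (simp add: a2)
  finally have *: "(1 + a) ^ 3 + (1 - a) ^ 3 = 8 * P w ^ 3" .
  have "((1/2) * y / P w) ^ 3 = y ^ 3 / (8 * P w ^ 3)" for y
    by (simp add: power_mult_distrib power_divide)
  then have "fermat_x w ^ 3 + fermat_y w ^ 3 = ((1 + a) ^ 3 + (1 - a) ^ 3) / (8 * P w ^ 3)"
    unfolding fermat_x_def fermat_y_def a_def[symmetric] by (simp only: add_divide_distrib)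
  then show ?thesis using * assms(2) by simp
qed

lemma fermat_cubes_cosparse: "\<forall>\<^sub>\<approx>w\<in>UNIV. fermat_x w ^ 3 + fermat_y w ^ 3 = 1"
  using off_lattice wp_nonzero by eventually_elim (rule fermat_cubes)

lemma fermat_x_uminus: "w \<notin> \<Lambda> \<Longrightarrow> fermat_x (- w) = fermat_y w"
  by (simp add: fermat_x_def fermat_y_def wp_even deriv_wp_odd)

lemma fermat_x_analytic: "w \<notin> \<Lambda> \<Longrightarrow> P w \<noteq> 0 \<Longrightarrow> fermat_x analytic_on {w}"
  unfolding fermat_x_def by (intro analytic_intros wp_analytic deriv_wp_analytic) auto

lemma fermat_y_analytic: "w \<notin> \<Lambda> \<Longrightarrow> P w \<noteq> 0 \<Longrightarrow> fermat_y analytic_on {w}"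
  unfolding fermat_y_def by (intro analytic_intros wp_analytic deriv_wp_analytic) auto

lemma fermat_x_meromorphic: "fermat_x meromorphic_on UNIV"
  unfolding fermat_x_def by (intro meromorphic_intros wp_meromorphic)

lemma fermat_y_meromorphic: "fermat_y meromorphic_on UNIV"
  unfolding fermat_y_def by (intro meromorphic_intros wp_meromorphic)

lemma fermat_x_periodic: "\<tau> \<in> \<Lambda> \<Longrightarrow> fermat_x (w + \<tau>) = fermat_x w"
  by (simp add: fermat_x_def wp_periodic deriv_wp_periodic)

text \<open>The differential dx/y^2 of the cubic pulls back to sqrt 3 dw.\<close>

lemma fermat_x_deriv:
  assumes w: "w \<notin> \<Lambda>" "P w \<noteq> 0" "deriv P w \<noteq> 0"
  shows "(fermat_x has_field_derivative of_real (sqrt 3) * fermat_y w ^ 2) (at w)"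
proof -
  define s where "s = complex_of_real (sqrt 3)"
  have s: "s ^ 2 = 3" "s \<noteq> 0" using sqrt3_sq by (auto simp: s_def)
  define p where "p = P w"
  define a where "a = deriv P w / s"
  have p: "p \<noteq> 0" using w by (simp add: p_def)
  have da: "deriv P w = s * a" using s by (simp add: a_def)
  have a2: "3 * a ^ 2 = 4 * p ^ 3 - 1"
    using ode[OF w(1)] by (simp add: da power_mult_distrib s p_def)
  have "(fermat_x has_field_derivative
      ((1/2) * (6 * p ^ 2 / s) * p - (1/2) * (1 + a) * (s * a)) / (p * p)) (at w)"
    unfolding fermat_x_def s_def[symmetric]
  proof (rule DERIV_cong)
    show "((\<lambda>w. (1/2) * (1 + deriv P w / s) / P w) has_field_derivative
        ((1/2) * (0 + 6 * P w ^ 2 / s) * P w - (1/2) * (1 + deriv P w / s) * deriv P w) / (P w * P w)) (at w)"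
      by (intro DERIV_divide DERIV_cmult DERIV_add DERIV_const DERIV_cdivide wp_deriv2 wp_deriv w)
    show "((1/2) * (0 + 6 * P w ^ 2 / s) * P w - (1/2) * (1 + deriv P w / s) * deriv P w) / (P w * P w)
        = ((1/2) * (6 * p ^ 2 / s) * p - (1/2) * (1 + a) * (s * a)) / (p * p)"
      unfolding a_def[symmetric] unfolding da p_def[symmetric] by simp
  qed
  moreover have "((1/2) * (6 * p ^ 2 / s) * p - (1/2) * (1 + a) * (s * a)) / (p * p) = s * fermat_y w ^ 2"
  proof -
    have "6 / s = 2 * s" using s by (simp add: field_simps power2_eq_square)
    then have "6 * p ^ 2 / s = 2 * s * p ^ 2" by (metis (no_types, lifting) times_divide_eq_left mult.commute)
    then have "(1/2) * (6 * p ^ 2 / s) * p - (1/2) * (1 + a) * (s * a) = s / 4 * (4 * p ^ 3 - 2 * a - 2 * a ^ 2)"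
      by (simp add: algebra_simps power2_eq_square power3_eq_cube)
    also have "4 * p ^ 3 = 3 * a ^ 2 + 1" using a2 by simp
    also have "s / 4 * (3 * a ^ 2 + 1 - 2 * a - 2 * a ^ 2) = s * ((1/2) * (1 - a)) ^ 2"
      by (simp add: algebra_simps power2_eq_square)
    finally have N: "(1/2) * (6 * p ^ 2 / s) * p - (1/2) * (1 + a) * (s * a) = s * ((1/2) * (1 - a)) ^ 2" .
    have "fermat_y w = (1/2) * (1 - a) / p"
      by (simp only: fermat_y_def s_def[symmetric] a_def[symmetric] p_def[symmetric])
    then show ?thesis unfolding N by (simp only: power_divide power2_eq_square[of p] times_divide_eq_right)
  qed
  ultimately show ?thesis by (simp add: s_def)
qed

lemma regular_points: "\<forall>\<^sub>\<approx>w\<in>UNIV. w \<notin> \<Lambda> \<and> P w \<noteq> 0 \<and> deriv P w \<noteq> 0"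
  using off_lattice wp_nonzero deriv_wp_nonzero by eventually_elim simp

lemma fermat_x_pole: "is_pole fermat_x \<theta>\<^sub>1"
  unfolding fermat_x_def
proof (rule is_pole_divide)
  show "isCont (\<lambda>w. 1 / 2 * (1 + deriv P w / complex_of_real (sqrt 3))) \<theta>\<^sub>1"
    using analytic_at_imp_isCont[OF deriv_wp_analytic[OF th1(1)]]
    by (intro continuous_intros) auto
  have "P \<midarrow>\<theta>\<^sub>1\<rightarrow> 0" using analytic_at_imp_isCont[OF wp_analytic[OF th1(1)]] th1(2) by (simp add: isCont_def)
  then show "filterlim P (at 0) (at \<theta>\<^sub>1)"
    using eventually_cosparse_imp_eventually_at[OF wp_nonzero, of \<theta>\<^sub>1 UNIV] by (simp add: filterlim_at)
  show "1 / 2 * (1 + deriv P \<theta>\<^sub>1 / complex_of_real (sqrt 3)) \<noteq> 0"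
    using th1(3) by (simp add: complex_eq_iff)
qed

lemma fermat_y_nonzero: "\<forall>\<^sub>\<approx>w\<in>UNIV. fermat_y w \<noteq> 0"
proof -
  have "\<not> (\<forall>\<^sub>\<approx>w\<in>UNIV. fermat_y w = 0)"
  proof
    assume "\<forall>\<^sub>\<approx>w\<in>UNIV. fermat_y w = 0"
    then have "\<forall>\<^sub>\<approx>w\<in>UNIV. fermat_y (- 1 * w + 0) = 0" by (rule cosparse_affine) simp
    moreover have "\<forall>\<^sub>\<approx>w\<in>UNIV. - 1 * w + 0 \<notin> \<Lambda>" by (rule cosparse_affine[OF off_lattice]) simp
    ultimately have "\<forall>\<^sub>\<approx>w\<in>UNIV. fermat_x w = 0"
      by eventually_elim (use fermat_x_uminus in \<open>force simp flip: fermat_x_uminus\<close>)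
    then have "\<forall>\<^sub>F w in at \<theta>\<^sub>1. fermat_x w = 0" using eventually_cosparse_imp_eventually_at by blast
    moreover have "\<forall>\<^sub>F w in at \<theta>\<^sub>1. norm (fermat_x w) > 0" by (rule is_pole_eventually_large[OF fermat_x_pole])
    ultimately have "\<forall>\<^sub>F w in at \<theta>\<^sub>1. False" by eventually_elim simp
    then show False by simp
  qed
  moreover have "(\<forall>\<^sub>\<approx>w\<in>UNIV. fermat_y w = 0) \<or> (\<forall>\<^sub>\<approx>w\<in>UNIV. fermat_y w \<noteq> 0)"
    by (rule meromorphic_imp_constant_or_avoid[OF fermat_y_meromorphic]) auto
  ultimately show ?thesis by blast
qed

lemma fermat_x_cube_rotate:
  assumes "\<rho> ^ 3 = 1"
  shows "\<forall>\<^sub>\<approx>w\<in>UNIV. fermat_x (\<rho> * w) ^ 3 = fermat_x w ^ 3"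
  using wp_rotate[OF assms] deriv_wp_rotate[OF assms]
  by eventually_elim (simp add: fermat_x_def power_mult_distrib power_divide assms)

text \<open>At the zeros of P, where F has poles, the functions \<phi> = 1/F and \<psi> = G/F are analytic. They
  satisfy \<phi>' = - sqrt 3 \<psi>^2 and \<psi>^3 = \<phi>^3 - 1, so the cube of \<phi>' is a function of \<phi>.\<close>

lemma fermat_recip_deriv:
  assumes w: "w \<notin> \<Lambda>" "deriv P w \<noteq> 0" and A: "1 + deriv P w / of_real (sqrt 3) \<noteq> 0"
  shows "((\<lambda>w. 2 * P w / (1 + deriv P w / of_real (sqrt 3))) has_field_derivative
           - of_real (sqrt 3) * ((1 - deriv P w / of_real (sqrt 3)) / (1 + deriv P w / of_real (sqrt 3))) ^ 2) (at w)"
    and "((1 - deriv P w / of_real (sqrt 3)) / (1 + deriv P w / of_real (sqrt 3))) ^ 3 =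
          (2 * P w / (1 + deriv P w / of_real (sqrt 3))) ^ 3 - 1"
proof -
  define s where "s = complex_of_real (sqrt 3)"
  have s: "s ^ 2 = 3" "s \<noteq> 0" using sqrt3_sq by (auto simp: s_def)
  define p where "p = P w"
  define a where "a = deriv P w / s"
  have A': "1 + a \<noteq> 0" using A by (simp add: a_def s_def)
  have da: "deriv P w = s * a" using s by (simp add: a_def)
  have a2: "3 * a ^ 2 = 4 * p ^ 3 - 1"
    using ode[OF w(1)] by (simp add: da power_mult_distrib s p_def)
  have "((\<lambda>w. 2 * P w / (1 + deriv P w / s)) has_field_derivative
      (2 * (s * a) * (1 + a) - 2 * p * (6 * p ^ 2 / s)) / ((1 + a) * (1 + a))) (at w)"
  proof (rule DERIV_cong)
    show "((\<lambda>w. 2 * P w / (1 + deriv P w / s)) has_field_derivative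
        (2 * deriv P w * (1 + deriv P w / s) - 2 * P w * (0 + 6 * P w ^ 2 / s)) /
          ((1 + deriv P w / s) * (1 + deriv P w / s))) (at w)"
      using A unfolding s_def[symmetric]
      by (intro DERIV_divide DERIV_cmult DERIV_add DERIV_const DERIV_cdivide wp_deriv2 wp_deriv w)
    show "(2 * deriv P w * (1 + deriv P w / s) - 2 * P w * (0 + 6 * P w ^ 2 / s)) /
          ((1 + deriv P w / s) * (1 + deriv P w / s)) =
        (2 * (s * a) * (1 + a) - 2 * p * (6 * p ^ 2 / s)) / ((1 + a) * (1 + a))"
      unfolding a_def[symmetric] unfolding da p_def[symmetric] by simp
  qed
  moreover have "(2 * (s * a) * (1 + a) - 2 * p * (6 * p ^ 2 / s)) / ((1 + a) * (1 + a)) = - s * ((1 - a) / (1 + a)) ^ 2"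
  proof -
    have "6 / s = 2 * s" using s by (simp add: field_simps power2_eq_square)
    then have "6 * p ^ 2 / s = 2 * s * p ^ 2" by (metis (no_types, lifting) times_divide_eq_left mult.commute)
    then have "2 * (s * a) * (1 + a) - 2 * p * (6 * p ^ 2 / s) = s * (2 * a + 2 * a ^ 2 - 4 * p ^ 3)"
      by (simp add: algebra_simps power2_eq_square power3_eq_cube)
    also have "4 * p ^ 3 = 3 * a ^ 2 + 1" using a2 by simp
    also have "s * (2 * a + 2 * a ^ 2 - (3 * a ^ 2 + 1)) = - s * (1 - a) ^ 2"
      by (simp add: algebra_simps power2_eq_square)
    finally show ?thesis by (simp add: power_divide power2_eq_square)
  qed
  ultimately show "((\<lambda>w. 2 * P w / (1 + deriv P w / of_real (sqrt 3))) has_field_derivative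
           - of_real (sqrt 3) * ((1 - deriv P w / of_real (sqrt 3)) / (1 + deriv P w / of_real (sqrt 3))) ^ 2) (at w)"
    by (simp add: s_def a_def)
  have "(1 - a) ^ 3 + (1 + a) ^ 3 = 2 + 2 * (3 * a ^ 2)"
    by (simp add: power2_eq_square power3_eq_cube algebra_simps)
  also have "\<dots> = (2 * p) ^ 3" unfolding a2 by (simp add: power_mult_distrib)
  finally have "(1 - a) ^ 3 = (2 * p) ^ 3 - (1 + a) ^ 3" by (simp add: algebra_simps)
  then have "(1 - a) ^ 3 / (1 + a) ^ 3 = (2 * p) ^ 3 / (1 + a) ^ 3 - 1"
    using A' by (simp only: diff_divide_distrib) simp
  then have "((1 - a) / (1 + a)) ^ 3 = (2 * p / (1 + a)) ^ 3 - 1"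
    by (simp only: power_divide)
  then show "((1 - deriv P w / of_real (sqrt 3)) / (1 + deriv P w / of_real (sqrt 3))) ^ 3 =
          (2 * P w / (1 + deriv P w / of_real (sqrt 3))) ^ 3 - 1"
    by (simp add: a_def p_def s_def)
qed

text \<open>Both functions 1/F(z + \<theta>1) and 1/F(z + \<theta>2) vanish at z = 0 and satisfy an equation
  u'^3 = R(u) in which R(u) depends only on u^3. After multiplying one of them by a cube root of
  unity their slopes agree as well, so they coincide.\<close>

lemma fermat_x_cube_at_zeros:
  "\<forall>\<^sub>\<approx>z\<in>UNIV. fermat_x (z + \<theta>\<^sub>1) ^ 3 = fermat_x (z + \<theta>\<^sub>2) ^ 3"
proof -
  define s where "s = complex_of_real (sqrt 3)"
  have s0: "s \<noteq> 0" by (simp add: s_def)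
  define \<phi> where "\<phi> = (\<lambda>w. 2 * P w / (1 + deriv P w / s))"
  define \<psi> where "\<psi> = (\<lambda>w. (1 - deriv P w / s) / (1 + deriv P w / s))"
  define good where "good = (\<lambda>w. w \<notin> \<Lambda> \<and> deriv P w \<noteq> 0 \<and> 1 + deriv P w / s \<noteq> 0)"
  have d\<phi>: "(\<phi> has_field_derivative - s * \<psi> w ^ 2) (at w)" and \<psi>3: "\<psi> w ^ 3 = \<phi> w ^ 3 - 1" if "good w" for w
    using fermat_recip_deriv[of w] that unfolding good_def \<phi>_def \<psi>_def s_def by auto
  have \<phi>a: "\<phi> analytic_on {w}" if "good w" for w
    using that unfolding \<phi>_def good_def by (intro analytic_intros wp_analytic deriv_wp_analytic) (auto simp: s0)
  have goodn: "\<forall>\<^sub>F w in nhds w. good w" if "good w" for w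
  proof -
    have "(\<lambda>w. 1 + deriv P w / s) analytic_on {w}"
      using that unfolding good_def s_def by (intro analytic_intros deriv_wp_analytic) auto
    from analytic_tendsto_nhds[OF this]
    have "\<forall>\<^sub>F w in nhds w. 1 + deriv P w / s \<noteq> 0"
      using that unfolding good_def by (intro tendsto_imp_eventually_ne) auto
    moreover have "\<forall>\<^sub>F w in nhds w. deriv P w \<noteq> 0"
      using analytic_tendsto_nhds[OF deriv_wp_analytic, of w] that unfolding good_def
      by (intro tendsto_imp_eventually_ne) auto
    moreover have "\<forall>\<^sub>F w in nhds w. w \<notin> \<Lambda>" using that unfolding good_def by (intro off_lattice_nhds) auto
    ultimately show ?thesis unfolding good_def by eventually_elim simp
  qed
  have g1: "good \<theta>\<^sub>1" and g2: "good \<theta>\<^sub>2"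
    using th1 th2 by (auto simp: good_def s_def complex_eq_iff)
  have z1: "\<phi> \<theta>\<^sub>1 = 0" and z2: "\<phi> \<theta>\<^sub>2 = 0" using th1 th2 by (auto simp: \<phi>_def)
  have p1: "\<psi> \<theta>\<^sub>1 ^ 3 = - 1" and p2: "\<psi> \<theta>\<^sub>2 ^ 3 = - 1"
    using \<psi>3[OF g1] \<psi>3[OF g2] z1 z2 by auto
  (* The ratio of the two initial slopes. It is a cube root of unity, so multiplication by it
     preserves the differential equation. *)
  define \<rho> where "\<rho> = (\<psi> \<theta>\<^sub>1 / \<psi> \<theta>\<^sub>2) ^ 2"
  have "\<rho> ^ 3 = ((\<psi> \<theta>\<^sub>1 / \<psi> \<theta>\<^sub>2) ^ 3) ^ 2" unfolding \<rho>_def by (simp only: power_mult[symmetric] mult.commute)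
  then have \<rho>: "\<rho> ^ 3 = 1" by (simp add: power_divide p1 p2)
  have nz: "\<psi> \<theta>\<^sub>1 \<noteq> 0" "\<psi> \<theta>\<^sub>2 \<noteq> 0" using p1 p2 by auto
  have shift: "((\<lambda>z. c * \<phi> (z + t)) has_field_derivative c * (- s * \<psi> (z + t) ^ 2)) (at z)" if "good (z + t)" for c z t
  proof -
    have "((\<lambda>z. z + t) has_field_derivative 1) (at z)"
      using DERIV_add[OF DERIV_ident DERIV_const] by simp
    from DERIV_cmult[OF DERIV_chain2[OF d\<phi>[OF that] this], of c] show ?thesis by simp
  qed
  have evt: "\<forall>\<^sub>F z in nhds 0. good (z + t)" if "good t" for t
  proof -
    have "filterlim (\<lambda>z. z + t) (nhds t) (nhds 0)"
      using tendsto_add[OF tendsto_ident_at tendsto_const, of t "0::complex" UNIV] by (simp add: tendsto_nhds_iff)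
    then show ?thesis using goodn[OF that] by (simp add: filterlim_iff)
  qed
  have ode\<phi>: "\<forall>\<^sub>F z in nhds 0. deriv (\<lambda>z. c * \<phi> (z + t)) z ^ 3 = - (s ^ 3) * ((c * \<phi> (z + t)) ^ 3 - 1) ^ 2"
    if t: "good t" and c: "c ^ 3 = 1" for c t
    using evt[OF t]
  proof eventually_elim
    case (elim z)
    have "deriv (\<lambda>z. c * \<phi> (z + t)) z ^ 3 = (c * (- s * \<psi> (z + t) ^ 2)) ^ 3"
      using DERIV_imp_deriv[OF shift[OF elim]] by simp
    also have "\<dots> = - (s ^ 3) * (\<psi> (z + t) ^ 3) ^ 2"
      using c by (simp add: power_mult_distrib mult.commute flip: power_mult)
    also have "\<dots> = - (s ^ 3) * ((c * \<phi> (z + t)) ^ 3 - 1) ^ 2"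
      using \<psi>3[OF elim] c by (simp add: power_mult_distrib)
    finally show ?case .
  qed
  have an: "(\<lambda>z. c * \<phi> (z + t)) analytic_on {0}" if "good t" for c t
  proof -
    have "\<phi> analytic_on {(\<lambda>z. z + t) 0}" using \<phi>a[OF that] by simp
    then have "\<phi> \<circ> (\<lambda>z. z + t) analytic_on {0}"
      by (intro analytic_on_compose_gen[of _ _ \<phi> "{t}"] analytic_intros) auto
    then show ?thesis by (intro analytic_intros) (simp add: o_def)
  qed
  have "\<forall>\<^sub>F z in nhds 0. 1 * \<phi> (z + \<theta>\<^sub>1) = \<rho> * \<phi> (z + \<theta>\<^sub>2)"
  proof (rule ode_unique[where n = 3 and R = "\<lambda>y. - (s ^ 3) * (y ^ 3 - 1) ^ 2"])
    show "(\<lambda>z. 1 * \<phi> (z + \<theta>\<^sub>1)) analytic_on {0}" "(\<lambda>z. \<rho> * \<phi> (z + \<theta>\<^sub>2)) analytic_on {0}"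
      using an[OF g1] an[OF g2] by blast+
    have "deriv (\<lambda>z. 1 * \<phi> (z + \<theta>\<^sub>1)) 0 = - s * \<psi> \<theta>\<^sub>1 ^ 2"
      using DERIV_imp_deriv[OF shift[of 0 \<theta>\<^sub>1 1]] g1 by simp
    moreover have "deriv (\<lambda>z. \<rho> * \<phi> (z + \<theta>\<^sub>2)) 0 = \<rho> * (- s * \<psi> \<theta>\<^sub>2 ^ 2)"
      using DERIV_imp_deriv[OF shift[of 0 \<theta>\<^sub>2 \<rho>]] g2 by simp
    ultimately show "deriv (\<lambda>z. 1 * \<phi> (z + \<theta>\<^sub>1)) 0 = deriv (\<lambda>z. \<rho> * \<phi> (z + \<theta>\<^sub>2)) 0"
      "deriv (\<lambda>z. \<rho> * \<phi> (z + \<theta>\<^sub>2)) 0 \<noteq> 0"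
      using nz by (auto simp: \<rho>_def power_divide s_def)
    show "\<forall>\<^sub>F z in nhds 0. deriv (\<lambda>z. 1 * \<phi> (z + \<theta>\<^sub>1)) z ^ 3 = - (s ^ 3) * ((1 * \<phi> (z + \<theta>\<^sub>1)) ^ 3 - 1) ^ 2"
      by (rule ode\<phi>[OF g1]) simp
    show "\<forall>\<^sub>F z in nhds 0. deriv (\<lambda>z. \<rho> * \<phi> (z + \<theta>\<^sub>2)) z ^ 3 = - (s ^ 3) * ((\<rho> * \<phi> (z + \<theta>\<^sub>2)) ^ 3 - 1) ^ 2"
      by (rule ode\<phi>[OF g2 \<rho>])
  qed (use z1 z2 in auto)
  then have fr: "\<forall>\<^sub>F z in nhds 0. \<phi> (z + \<theta>\<^sub>1) = \<rho> * \<phi> (z + \<theta>\<^sub>2)" by simp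
  have m: "\<phi> meromorphic_on UNIV"
    unfolding \<phi>_def by (intro meromorphic_intros wp_meromorphic)
  have "mero_eq (\<lambda>z. \<phi> (z + \<theta>\<^sub>1)) (\<lambda>z. \<rho> * \<phi> (z + \<theta>\<^sub>2))"
    by (rule mero_eq_identity[OF _ _ fr])
      (intro meromorphic_intros mero_compose_entire[OF m] holomorphic_intros)+
  then have ev: "\<forall>\<^sub>\<approx>z\<in>UNIV. \<phi> (z + \<theta>\<^sub>1) = \<rho> * \<phi> (z + \<theta>\<^sub>2)" by (simp add: mero_eq_def)
  have "fermat_x w = 1 / \<phi> w" for w by (simp add: fermat_x_def \<phi>_def s_def)
  then show ?thesis
    using eventually_mono[OF ev] by (simp add: power_divide power_mult_distrib \<rho>)
qed

text \<open>The shifts by \<theta>1 and \<theta>2 are translations by 3-torsion points; on the cubic they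
  multiply the first coordinate by a cube root of unity.\<close>

lemma fermat_x_cube_translate:
  assumes "t \<in> \<Lambda> \<or> t - \<theta>\<^sub>1 \<in> \<Lambda> \<or> t - \<theta>\<^sub>2 \<in> \<Lambda>"
  shows "\<forall>\<^sub>\<approx>z\<in>UNIV. fermat_x (z + t) ^ 3 = fermat_x z ^ 3"
proof -
  have per: "fermat_x (z + t) = fermat_x (z + t')" if "t - t' \<in> \<Lambda>" for z t t'
    using fermat_x_periodic[OF that, of "z + t'"] by simp
  have 1: "\<forall>\<^sub>\<approx>z\<in>UNIV. fermat_x (z + \<theta>\<^sub>1) ^ 3 = fermat_x z ^ 3"
  proof -
    have "(\<theta>\<^sub>1 + \<theta>\<^sub>2) - 3 * \<theta>\<^sub>1 \<in> \<Lambda>" using zeros_sum_in_lattice three_zero_in_lattice by blast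
    (* Modulo periods, the shift by theta2 - theta1 is the shift by theta1. *)
    then have l: "(\<theta>\<^sub>2 - \<theta>\<^sub>1) - \<theta>\<^sub>1 \<in> \<Lambda>" by (simp add: algebra_simps)
    have "\<forall>\<^sub>\<approx>z\<in>UNIV. fermat_x (1 * z + (- \<theta>\<^sub>1) + \<theta>\<^sub>1) ^ 3 = fermat_x (1 * z + (- \<theta>\<^sub>1) + \<theta>\<^sub>2) ^ 3"
      by (rule cosparse_affine[OF fermat_x_cube_at_zeros]) simp
    then show ?thesis
      by eventually_elim (use per[OF l] in \<open>simp add: algebra_simps\<close>)
  qed
  have 2: "\<forall>\<^sub>\<approx>z\<in>UNIV. fermat_x (z + \<theta>\<^sub>2) ^ 3 = fermat_x z ^ 3"
    using fermat_x_cube_at_zeros 1 by eventually_elim simp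
  show ?thesis using assms
  proof (elim disjE)
    assume "t \<in> \<Lambda>"
    then show ?thesis by (simp add: fermat_x_periodic)
  next
    assume "t - \<theta>\<^sub>1 \<in> \<Lambda>"
    from 1 show ?thesis by eventually_elim (simp add: per[OF \<open>t - \<theta>\<^sub>1 \<in> \<Lambda>\<close>])
  next
    assume "t - \<theta>\<^sub>2 \<in> \<Lambda>"
    from 2 show ?thesis by eventually_elim (simp add: per[OF \<open>t - \<theta>\<^sub>2 \<in> \<Lambda>\<close>])
  qed
qed

text \<open>F has a pole at \<theta>1, so \<eta> F does too, and B \<theta>1 + c must be a period or a
  zero of P. The point B \<theta>1 is congruent to \<theta>1, which leaves three classes for c.\<close>

lemma fermat_x_self_map:
  assumes eq: "\<forall>\<^sub>\<approx>w\<in>UNIV. fermat_x (B * w + c) = \<eta> * fermat_x w" and B: "B ^ 3 = 1" and \<eta>: "\<eta> ^ 3 = 1"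
  shows "c \<in> \<Lambda> \<or> c - \<theta>\<^sub>1 \<in> \<Lambda> \<or> c - \<theta>\<^sub>2 \<in> \<Lambda>"
proof -
  define x where "x = B * \<theta>\<^sub>1 + c"
  have "x \<in> \<Lambda> \<or> P x = 0"
  proof (rule ccontr)
    assume "\<not> ?thesis"
    then have "fermat_x analytic_on {x}" using fermat_x_analytic by blast
    then have "fermat_x \<circ> (\<lambda>w. B * w + c) analytic_on {\<theta>\<^sub>1}"
      by (intro analytic_on_compose_gen[of _ _ fermat_x "{x}"] analytic_intros) (auto simp: x_def)
    then have "\<not> is_pole (\<lambda>w. fermat_x (B * w + c)) \<theta>\<^sub>1"
      using analytic_at_imp_no_pole by (auto simp: o_def)
    moreover have "\<forall>\<^sub>F w in at \<theta>\<^sub>1. fermat_x (B * w + c) = \<eta> * fermat_x w"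
      using eq eventually_cosparse_imp_eventually_at by blast
    ultimately have "\<not> is_pole (\<lambda>w. \<eta> * fermat_x w) \<theta>\<^sub>1"
      using is_pole_cong[of "\<lambda>w. fermat_x (B * w + c)" "\<lambda>w. \<eta> * fermat_x w" \<theta>\<^sub>1 \<theta>\<^sub>1] by blast
    moreover have "is_pole (\<lambda>w. \<eta> * fermat_x w) \<theta>\<^sub>1"
      using \<eta> by (intro is_pole_mult_analytic_nonzero1 fermat_x_pole analytic_intros) auto
    ultimately show False by blast
  qed
  then consider "x \<in> \<Lambda>" | "x - \<theta>\<^sub>1 \<in> \<Lambda>" | "x - \<theta>\<^sub>2 \<in> \<Lambda>" using wp_zeros by blast
  then show ?thesis
  proof cases
    (* Modulo periods, c = - \<theta>1 = \<theta>2. *)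
    case 1
    have "c - \<theta>\<^sub>2 = x + (\<theta>\<^sub>1 - B * \<theta>\<^sub>1) - (\<theta>\<^sub>1 + \<theta>\<^sub>2)" by (simp add: x_def)
    then show ?thesis using 1 zero_rotate[OF B] zeros_sum_in_lattice by (metis lattice_add lattice_diff)
  next
    case 2
    have "c = (x - \<theta>\<^sub>1) + (\<theta>\<^sub>1 - B * \<theta>\<^sub>1)" by (simp add: x_def)
    then show ?thesis using 2 zero_rotate[OF B] by (metis lattice_add)
  next
    (* Modulo periods, c = \<theta>2 - \<theta>1 = - 2 \<theta>1 = \<theta>1. *)
    case 3
    have "c - \<theta>\<^sub>1 = (x - \<theta>\<^sub>2) + (\<theta>\<^sub>1 - B * \<theta>\<^sub>1) + (\<theta>\<^sub>1 + \<theta>\<^sub>2) - 3 * \<theta>\<^sub>1" by (simp add: x_def)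
    then show ?thesis using 3 zero_rotate[OF B] zeros_sum_in_lattice three_zero_in_lattice by (metis lattice_add lattice_diff)
  qed
qed

lemma fermat_x_affine:
  assumes A: "A ^ 3 = - 1" and t: "t \<in> \<Lambda> \<or> t - \<theta>\<^sub>1 \<in> \<Lambda> \<or> t - \<theta>\<^sub>2 \<in> \<Lambda>"
  shows "\<forall>\<^sub>\<approx>w\<in>UNIV. fermat_x w ^ 3 + fermat_x (A * w + t) ^ 3 = 1"
proof -
  have A0: "A \<noteq> 0" using A by auto
  have A3: "(- A) ^ 3 = 1" using A by simp
  have "\<forall>\<^sub>\<approx>w\<in>UNIV. fermat_x ((A * w + 0) + t) ^ 3 = fermat_x (A * w + 0) ^ 3"
    by (rule cosparse_affine[OF fermat_x_cube_translate[OF t] A0])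
  moreover have "\<forall>\<^sub>\<approx>w\<in>UNIV. fermat_x (- A * (- 1 * w + 0)) ^ 3 = fermat_x (- 1 * w + 0) ^ 3"
    by (rule cosparse_affine[OF fermat_x_cube_rotate[OF A3]]) simp
  ultimately show ?thesis using off_lattice fermat_cubes_cosparse
    by eventually_elim (simp add: fermat_x_uminus)
qed

end

section \<open>Lifting solutions of the Fermat equation\<close>

text \<open>On the cubic, dx/y^2 = - dy/x^2 is the holomorphic differential, so its pull-back along
  (f, g) has no poles.\<close>

lemma fermat_differential_entire:
  assumes f: "f meromorphic_on UNIV" and g: "g meromorphic_on UNIV"
    and eq: "\<forall>\<^sub>\<approx>z\<in>UNIV. f z ^ 3 + g z ^ 3 = 1"
  shows "remove_sings (\<lambda>z. deriv f z / g z ^ 2) holomorphic_on UNIV"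
proof (rule entire_if_locally_bounded)
  show "(\<lambda>z. deriv f z / g z ^ 2) meromorphic_on UNIV" by (intro meromorphic_intros f g)
  fix z :: complex
  have eqz: "\<forall>\<^sub>F w in at z. f w ^ 3 + g w ^ 3 = 1"
    using eq eventually_cosparse_imp_eventually_at by blast
  have anf: "\<forall>\<^sub>F w in at z. f analytic_on {w}" and ang: "\<forall>\<^sub>F w in at z. g analytic_on {w}"
    using meromorphic_on_imp_analytic_cosparse[OF f] meromorphic_on_imp_analytic_cosparse[OF g]
      eventually_cosparse_imp_eventually_at by blast+
  show "\<exists>B. \<forall>\<^sub>F w in at z. norm (deriv f w / g w ^ 2) \<le> B"
  proof (cases "is_pole f z")
    case True
    (* Here f'/g^2 = - (1/f)' (f/g)^2, where 1/f extends analytically and (g/f)^3 = 1/f^3 - 1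
       stays away from 0. *)
    define u where "u = (\<lambda>w. 1 / f w)"
    have um: "u meromorphic_on UNIV" unfolding u_def by (intro meromorphic_intros f)
    have u0: "u \<midarrow>z\<rightarrow> 0" using is_pole_tendsto[OF True] by (simp add: u_def o_def inverse_eq_divide)
    then have "remove_sings u analytic_on {z}"
      using um by (intro remove_sings_analytic_at) (auto simp: meromorphic_on_altdef)
    then have "deriv (remove_sings u) analytic_on {z}" by (rule analytic_deriv)
    then obtain B where B: "\<forall>\<^sub>F w in at z. norm (deriv (remove_sings u) w) \<le> B"
      using analytic_locally_bounded by blast
    have "\<forall>\<^sub>F w in at z. norm (f w) > 2" by (rule is_pole_eventually_large[OF True])
    with eqz anf B have "\<forall>\<^sub>F w in at z. norm (deriv f w / g w ^ 2) \<le> B * 4"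
    proof eventually_elim
      case (elim w)
      have fw: "f w \<noteq> 0" using elim(4) by auto
      have "(u has_field_derivative - deriv f w / f w ^ 2) (at w)"
        unfolding u_def using DERIV_divide[OF DERIV_const[of 1] analytic_derivI[OF elim(2)] fw]
        by (simp add: power2_eq_square)
      then have du: "deriv u w = - deriv f w / f w ^ 2" by (rule DERIV_imp_deriv)
      have "u analytic_on {w}" unfolding u_def using elim(2) fw by (intro analytic_intros) auto
      then have "deriv (remove_sings u) w = deriv u w" by simp
      then have 1: "norm (deriv f w / f w ^ 2) \<le> B" using elim(3) by (simp add: du norm_divide)
      have "(g w / f w) ^ 3 = u w ^ 3 - 1"
      proof -
        have "g w ^ 3 = 1 - f w ^ 3" using elim(1) by (simp add: algebra_simps)
        then show ?thesis using fw by (simp add: u_def power_divide diff_divide_distrib)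
      qed
      moreover have "norm (u w ^ 3) \<le> (1 / 2) ^ 3"
        unfolding norm_power using elim(4) by (intro power_mono) (auto simp: u_def norm_divide divide_simps)
      ultimately have "norm ((g w / f w) ^ 3) \<ge> (1 / 2) ^ 3"
        using norm_triangle_ineq2[of 1 "u w ^ 3"] by (simp add: norm_minus_commute power3_eq_cube)
      then have "norm (g w / f w) \<ge> 1 / 2"
        unfolding norm_power using power_mono_iff[of "1/2" "norm (g w / f w)" 3] by simp
      then have 2: "norm (f w / g w) \<le> 2" 
        using fw by (auto simp: norm_divide divide_simps split: if_splits)
      have "norm (deriv f w / g w ^ 2) = norm (deriv f w / f w ^ 2) * norm (f w / g w) ^ 2"
        using fw by (simp add: norm_divide norm_power power_divide)
      also have "\<dots> \<le> B * 2 ^ 2"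
        using 1 2 order_trans[OF norm_ge_zero 1] by (intro mult_mono power_mono) auto
      finally show ?case by simp
    qed
    then show ?thesis by blast
  next
    case False
    define F where "F = remove_sings f"
    define G where "G = remove_sings g"
    have Fa: "F analytic_on {z}" unfolding F_def by (rule remove_sings_analytic_if_not_pole[OF f False])
    have Ff: "\<forall>\<^sub>F w in at z. F w = f w" unfolding F_def
      using f by (intro eventually_remove_sings_eq_at) (auto simp: meromorphic_on_altdef)
    obtain B where B: "\<forall>\<^sub>F w in at z. norm (F w) \<le> B" using analytic_locally_bounded[OF Fa] by blast
    have "\<not> is_pole g z"
    proof
      assume "is_pole g z"
      then have "\<forall>\<^sub>F w in at z. norm (g w) > 1 + \<bar>B\<bar>" by (rule is_pole_eventually_large)
      with B Ff eqz have "\<forall>\<^sub>F w in at z. False"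
      proof eventually_elim
        case (elim w)
        have "g w ^ 3 = 1 - f w ^ 3" using elim(3) by (simp add: algebra_simps)
        then have "norm (g w) ^ 3 \<le> 1 + norm (f w) ^ 3"
          using norm_triangle_ineq4[of 1 "f w ^ 3"] by (simp flip: norm_power)
        also have "\<dots> \<le> 1 + \<bar>B\<bar> ^ 3" using elim(1,2) by (intro add_mono power_mono) auto
        also have "\<dots> \<le> (1 + \<bar>B\<bar>) ^ 3" by (simp add: power3_eq_cube algebra_simps)
        also have "\<dots> < norm (g w) ^ 3" using elim(4) by (intro power_strict_mono) auto
        finally show False by simp
      qed
      then show False by simp
    qed
    then have Ga: "G analytic_on {z}" unfolding G_def by (rule remove_sings_analytic_if_not_pole[OF g])
    have Gg: "\<forall>\<^sub>F w in at z. G w = g w" unfolding G_def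
      using g by (intro eventually_remove_sings_eq_at) (auto simp: meromorphic_on_altdef)
    have "F z ^ 3 + G z ^ 3 = 1"
    proof -
      have "(\<lambda>w. F w ^ 3 + G w ^ 3) \<midarrow>z\<rightarrow> F z ^ 3 + G z ^ 3"
        using Fa Ga by (intro isContD[OF analytic_at_imp_isCont] analytic_intros)
      moreover have "\<forall>\<^sub>F w in at z. F w ^ 3 + G w ^ 3 = 1"
        using Ff Gg eqz by eventually_elim simp
      then have "(\<lambda>w. F w ^ 3 + G w ^ 3) \<midarrow>z\<rightarrow> 1" by (rule tendsto_eventually)
      ultimately show ?thesis by (rule LIM_unique)
    qed
    then consider "G z \<noteq> 0" | "F z \<noteq> 0" by fastforce
    then show ?thesis
    proof cases
      case 1
      then have "(\<lambda>w. deriv F w / G w ^ 2) analytic_on {z}"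
        using Fa Ga by (intro analytic_intros) auto
      then obtain C where "\<forall>\<^sub>F w in at z. norm (deriv F w / G w ^ 2) \<le> C"
        using analytic_locally_bounded by blast
      with Gg anf have "\<forall>\<^sub>F w in at z. norm (deriv f w / g w ^ 2) \<le> C"
        by eventually_elim (simp add: F_def)
      then show ?thesis by blast
    next
      (* Differentiating the relation gives f'/g^2 = - g'/f^2. *)
      case 2
      then have "(\<lambda>w. deriv G w / F w ^ 2) analytic_on {z}"
        using Fa Ga by (intro analytic_intros) auto
      then obtain C where C: "\<forall>\<^sub>F w in at z. norm (deriv G w / F w ^ 2) \<le> C"
        using analytic_locally_bounded by blast
      have "\<forall>\<^sub>F w in at z. F w \<noteq> 0"
        using 2 isContD[OF analytic_at_imp_isCont[OF Fa]] by (intro tendsto_imp_eventually_ne) auto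
      moreover have "\<forall>\<^sub>F w in at z. \<forall>\<^sub>F x in nhds w. f x ^ 3 + g x ^ 3 = 1"
        using cosparse_eventually_nhds[OF eq] eventually_cosparse_imp_eventually_at by blast
      ultimately have "\<forall>\<^sub>F w in at z. norm (deriv f w / g w ^ 2) \<le> C"
        using C Ff anf ang
      proof eventually_elim
        case (elim w)
        have fw: "f w \<noteq> 0" using elim by simp
        have "((\<lambda>x. f x ^ 3 + g x ^ 3) has_field_derivative
            3 * f w ^ 2 * deriv f w + 3 * g w ^ 2 * deriv g w) (at w)"
          using DERIV_add[OF DERIV_power[OF analytic_derivI[OF elim(5)], of 3] DERIV_power[OF analytic_derivI[OF elim(6)], of 3]]
          by (simp add: mult_ac)
        moreover have "deriv (\<lambda>x. f x ^ 3 + g x ^ 3) w = deriv (\<lambda>x. 1) w"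
          using elim(2) by (intro deriv_cong_ev) auto
        ultimately have "3 * f w ^ 2 * deriv f w + 3 * g w ^ 2 * deriv g w = 0"
          using DERIV_imp_deriv by fastforce
        then have "3 * (f w ^ 2 * deriv f w + g w ^ 2 * deriv g w) = 0"
          by (simp only: distrib_left mult.assoc)
        then have "f w ^ 2 * deriv f w + g w ^ 2 * deriv g w = 0"
          unfolding mult_eq_0_iff by simp
        then have d: "f w ^ 2 * deriv f w = - (g w ^ 2 * deriv g w)" by (simp add: eq_neg_iff_add_eq_0)
        have G': "deriv G w = deriv g w" using elim(6) by (simp add: G_def)
        show ?case
        proof (cases "g w = 0")
          case True
          then show ?thesis using order_trans[OF norm_ge_zero elim(3)] by simp
        next
          case False
          then have "deriv f w / g w ^ 2 = - (deriv g w / f w ^ 2)"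
            using d fw by (simp add: field_simps)
          then show ?thesis using elim(3,4) G' by simp
        qed
      qed
      then show ?thesis by blast
    qed
  qed
qed

context equianharmonic begin

text \<open>The lift starts at a point where f takes a value that F attains with nonzero derivative. Such a
  point exists since the values of f are dense and F maps a small disc of regular points onto an open set.\<close>

lemma fermat_lift:
  assumes f: "f meromorphic_on UNIV" "\<not> (\<exists>c. mero_eq f (\<lambda>_. c))" and g: "g meromorphic_on UNIV"
    and eq: "\<forall>\<^sub>\<approx>z\<in>UNIV. f z ^ 3 + g z ^ 3 = 1"
  obtains h \<eta> where "h holomorphic_on UNIV" "\<not> h constant_on UNIV" "\<eta> ^ 3 = 1"
    "mero_eq f (\<lambda>z. fermat_x (h z))" "mero_eq g (\<lambda>z. \<eta> * fermat_y (h z))"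
proof -
  define s where "s = complex_of_real (sqrt 3)"
  have s0: "s \<noteq> 0" by (simp add: s_def)
  define reg where "reg = (\<lambda>w. w \<notin> \<Lambda> \<and> P w \<noteq> 0 \<and> deriv P w \<noteq> 0 \<and> fermat_y w \<noteq> 0)"
  have reg: "\<forall>\<^sub>\<approx>w\<in>UNIV. reg w"
    using regular_points fermat_y_nonzero by eventually_elim (simp add: reg_def)
  have reg_an: "fermat_x analytic_on {w}" "fermat_y analytic_on {w}" if "reg w" for w
    using that fermat_x_analytic fermat_y_analytic by (auto simp: reg_def)
  have reg_d: "(fermat_x has_field_derivative s * fermat_y w ^ 2) (at w)" if "reg w" for w
    using that fermat_x_deriv by (auto simp: reg_def s_def)
  have reg_d0: "deriv fermat_x w \<noteq> 0" if "reg w" for w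
    using DERIV_imp_deriv[OF reg_d[OF that]] that s0 by (simp add: reg_def)
  have reg_nhds: "\<forall>\<^sub>\<approx>w\<in>UNIV. \<forall>\<^sub>F x in nhds w. reg x" by (rule cosparse_eventually_nhds[OF reg])
  obtain w1 where w1: "\<forall>\<^sub>F x in nhds w1. reg x"
    using eventually_happens[OF reg_nhds] by auto
  then obtain S where S: "open S" "w1 \<in> S" "\<And>x. x \<in> S \<Longrightarrow> reg x" by (auto simp: eventually_nhds)
  have hS: "fermat_x holomorphic_on S"
    using S reg_d by (auto simp: holomorphic_on_open)
  obtain r where r: "r > 0" "ball w1 r \<subseteq> S" "inj_on fermat_x (ball w1 r)"
    using has_complex_derivative_locally_injective[OF hS S(2,1) reg_d0[OF S(3)[OF S(2)]]] .
  have op: "open (fermat_x ` ball w1 r)"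
    by (rule open_mapping_thm3[OF _ open_ball r(3)]) (use hS r holomorphic_on_subset in blast)
  have gen: "\<forall>\<^sub>\<approx>z\<in>UNIV. f analytic_on {z} \<and> g analytic_on {z} \<and> (\<forall>\<^sub>F x in nhds z. f x ^ 3 + g x ^ 3 = 1)"
    using meromorphic_on_imp_analytic_cosparse[OF f(1)] meromorphic_on_imp_analytic_cosparse[OF g]
      cosparse_eventually_nhds[OF eq] by eventually_elim simp
  have "fermat_x ` ball w1 r \<noteq> {}" using r by auto
  from mero_values_dense[OF f gen op this] obtain z0 where
    z0: "f analytic_on {z0}" "g analytic_on {z0}" "\<forall>\<^sub>F x in nhds z0. f x ^ 3 + g x ^ 3 = 1"
      "f z0 \<in> fermat_x ` ball w1 r" by blast
  then obtain w0 where w0: "w0 \<in> ball w1 r" "f z0 = fermat_x w0" by blast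
  then have w0S: "w0 \<in> S" using r by blast
  have w0r: "reg w0" using S w0S by blast
  obtain k where k: "k analytic_on {z0}" "k z0 = w0" and Fk: "\<forall>\<^sub>F z in nhds z0. fermat_x (k z) = f z"
    using local_lift[OF reg_an(1)[OF w0r] reg_d0[OF w0r] z0(1) w0(2)] by metis
  have klim: "filterlim k (nhds w0) (nhds z0)" using analytic_tendsto_nhds[OF k(1)] k(2) by simp
  have "\<forall>\<^sub>F w in nhds w0. reg w"
    by (rule eventually_mono[OF eventually_nhds_in_open[OF S(1) w0S] S(3)])
  then have kS: "\<forall>\<^sub>F z in nhds z0. reg (k z)"
    using klim by (auto simp: filterlim_iff)
  have g0: "g z0 \<noteq> 0"
  proof -
    have "f z0 ^ 3 + g z0 ^ 3 = 1" using eventually_nhds_x_imp_x[OF z0(3)] .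
    moreover have "fermat_x w0 ^ 3 + fermat_y w0 ^ 3 = 1" using w0r by (intro fermat_cubes) (auto simp: reg_def)
    ultimately have "g z0 ^ 3 = fermat_y w0 ^ 3" using w0(2) by (metis add_left_cancel)
    then show ?thesis using w0r by (auto simp: reg_def)
  qed
  (* k lifts f; it lifts g only up to the cube root of unity R. *)
  define R where "R = (\<lambda>z. g z / fermat_y (k z))"
  have yk: "(\<lambda>z. fermat_y (k z)) analytic_on {z0}"
  proof -
    have "fermat_y \<circ> k analytic_on {z0}"
      by (rule analytic_on_compose_gen[OF k(1) reg_an(2)[OF w0r]]) (auto simp: k(2))
    then show ?thesis by (simp add: o_def)
  qed
  have Ra: "R analytic_on {z0}" unfolding R_def
    using z0(2) yk w0r k(2) by (intro analytic_intros) (auto simp: reg_def)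
  have R3: "\<forall>\<^sub>F z in nhds z0. R z ^ 3 = 1"
    using kS Fk z0(3)
  proof eventually_elim
    case (elim z)
    have "fermat_x (k z) ^ 3 + fermat_y (k z) ^ 3 = 1" using elim(1) by (intro fermat_cubes) (auto simp: reg_def)
    then have "g z ^ 3 = fermat_y (k z) ^ 3" using elim(2,3) by (metis add_left_cancel)
    then show ?case using elim(1) by (simp add: R_def power_divide reg_def)
  qed
  define \<eta> where "\<eta> = R z0"
  have \<eta>3: "\<eta> ^ 3 = 1" using eventually_nhds_x_imp_x[OF R3] by (simp add: \<eta>_def)
  have "\<forall>\<^sub>F z in nhds z0. R z = \<eta>" unfolding \<eta>_def
    by (rule analytic_root_of_unity_constant[OF Ra _ R3]) simp
  with kS have gk: "\<forall>\<^sub>F z in nhds z0. g z = \<eta> * fermat_y (k z)"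
    by eventually_elim (auto simp: R_def reg_def field_simps)
  (* The derivative of k continues to an entire function; its primitive is the global lift. *)
  define \<Phi> where "\<Phi> = remove_sings (\<lambda>z. deriv f z / g z ^ 2)"
  have \<Phi>: "\<Phi> holomorphic_on UNIV" unfolding \<Phi>_def by (rule fermat_differential_entire[OF f(1) g eq])
  have "(\<lambda>z. \<eta> ^ 2 / s * \<Phi> z) holomorphic_on UNIV" using \<Phi> by (intro holomorphic_intros) (auto simp: s0)
  then obtain H where H: "\<And>z. (H has_field_derivative \<eta> ^ 2 / s * \<Phi> z) (at z)"
    using holomorphic_convex_primitive'[of UNIV "\<lambda>z. \<eta> ^ 2 / s * \<Phi> z"] by auto
  define h where "h = (\<lambda>z. H z - H z0 + w0)"
  have dh: "(h has_field_derivative \<eta> ^ 2 / s * \<Phi> z) (at z)" for z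
    unfolding h_def using DERIV_add[OF DERIV_diff[OF H[of z] DERIV_const] DERIV_const] by simp
  have hol: "h holomorphic_on UNIV" using dh by (auto simp: holomorphic_on_open)
  have ha: "h analytic_on {z0}" using hol analytic_at by blast
  have gn: "\<forall>\<^sub>F z in nhds z0. g z \<noteq> 0"
    using analytic_tendsto_nhds[OF z0(2)] g0 by (rule tendsto_imp_eventually_ne)
  have Fk': "\<forall>\<^sub>F z in nhds z0. \<forall>\<^sub>F x in nhds z. fermat_x (k x) = f x"
    using Fk by (simp add: eventually_eventually)
  have "\<forall>\<^sub>F z in nhds z0. deriv k z = deriv h z"
    using kS Fk' gk gn analytic_eventually_analytic[OF k(1)] analytic_eventually_analytic[OF z0(1)]
      analytic_eventually_analytic[OF z0(2)]
  proof eventually_elim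
    case (elim z)
    have "((\<lambda>z. fermat_x (k z)) has_field_derivative s * fermat_y (k z) ^ 2 * deriv k z) (at z)"
      using DERIV_chain2[OF reg_d[OF elim(1)] analytic_derivI[OF elim(5)]] .
    then have "deriv (\<lambda>z. fermat_x (k z)) z = s * fermat_y (k z) ^ 2 * deriv k z"
      by (rule DERIV_imp_deriv)
    moreover have "deriv (\<lambda>z. fermat_x (k z)) z = deriv f z" using elim(2) by (intro deriv_cong_ev) auto
    ultimately have df: "deriv f z = s * fermat_y (k z) ^ 2 * deriv k z" by simp
    have "(\<lambda>z. deriv f z / g z ^ 2) analytic_on {z}"
      using elim(4,6,7) by (intro analytic_intros) auto
    then have "\<Phi> z = deriv f z / g z ^ 2" by (simp add: \<Phi>_def)
    also have "\<dots> = s * deriv k z / \<eta> ^ 2"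
      using elim(1) by (simp add: df elim(3) power_mult_distrib reg_def)
    finally have "deriv k z = \<eta> ^ 2 / s * \<Phi> z" using s0 \<eta>3 by (auto simp: field_simps)
    then show ?case using DERIV_imp_deriv[OF dh[of z]] by simp
  qed
  moreover have "k z0 = h z0" by (simp add: h_def k(2))
  ultimately have kh: "\<forall>\<^sub>F z in nhds z0. k z = h z"
    using eventually_eq_if_deriv_eq[OF k(1) ha] by blast
  have fh: "mero_eq f (\<lambda>z. fermat_x (h z))"
  proof (rule mero_eq_identity[OF f(1) mero_compose_entire[OF fermat_x_meromorphic hol]])
    show "\<forall>\<^sub>F z in nhds z0. f z = fermat_x (h z)" using Fk kh by eventually_elim simp
  qed
  have gh: "mero_eq g (\<lambda>z. \<eta> * fermat_y (h z))"
  proof (rule mero_eq_identity[OF g])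
    show "(\<lambda>z. \<eta> * fermat_y (h z)) meromorphic_on UNIV"
      by (intro meromorphic_intros mero_compose_entire[OF fermat_y_meromorphic hol])
    show "\<forall>\<^sub>F z in nhds z0. g z = \<eta> * fermat_y (h z)" using gk kh by eventually_elim simp
  qed
  have "\<not> h constant_on UNIV"
  proof
    assume "h constant_on UNIV"
    then obtain c where "\<And>z. h z = c" by (auto simp: constant_on_def)
    then have "mero_eq f (\<lambda>_. fermat_x c)" using fh by (simp add: mero_eq_def)
    then show False using f(2) by blast
  qed
  with hol show ?thesis using \<eta>3 fh gh by (rule that)
qed

text \<open>Since F(u)^3 = F(v)^3, also G(u)^3 = G(v)^3, so G(u)/G(v) is a constant r with r^3 = 1. With
  F' = sqrt 3 G^2, differentiating F(u) = \<eta> F(v) gives r^2 u' = \<eta> v'.\<close>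

lemma fermat_x_semiconj:
  assumes u: "u holomorphic_on UNIV" "\<not> u constant_on UNIV"
    and v: "v holomorphic_on UNIV" "\<not> v constant_on UNIV"
    and \<eta>: "\<eta> ^ 3 = 1" and eq: "\<forall>\<^sub>\<approx>z\<in>UNIV. fermat_x (u z) = \<eta> * fermat_x (v z)"
  obtains B c where "B ^ 3 = 1" "\<And>z. u z = B * v z + c"
    "c \<in> \<Lambda> \<or> c - \<theta>\<^sub>1 \<in> \<Lambda> \<or> c - \<theta>\<^sub>2 \<in> \<Lambda>"
proof -
  define s where "s = complex_of_real (sqrt 3)"
  have s0: "s \<noteq> 0" by (simp add: s_def)
  note cu = cosparse_compose_entire[OF u] and cv = cosparse_compose_entire[OF v]
  have "(\<lambda>z. fermat_y (u z) / fermat_y (v z)) meromorphic_on UNIV"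
    by (intro meromorphic_intros mero_compose_entire[OF fermat_y_meromorphic] u v)
  moreover have "\<forall>\<^sub>\<approx>z\<in>UNIV. (fermat_y (u z) / fermat_y (v z)) ^ 3 = 1"
    using eq cu[OF fermat_cubes_cosparse] cv[OF fermat_cubes_cosparse] cv[OF fermat_y_nonzero]
  proof eventually_elim
    case (elim z)
    have "fermat_x (u z) ^ 3 = fermat_x (v z) ^ 3" using elim(1) \<eta> by (simp add: power_mult_distrib)
    then have "fermat_y (u z) ^ 3 = fermat_y (v z) ^ 3" using elim(2,3) by (metis add_left_cancel)
    then show ?case using elim(4) by (simp add: power_divide)
  qed
  ultimately obtain r where r: "r ^ 3 = 1" "\<forall>\<^sub>\<approx>z\<in>UNIV. fermat_y (u z) / fermat_y (v z) = r"
    using mero_cube_root_of_unity by (auto simp: mero_eq_def)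
  define B where "B = \<eta> * r"
  have B3: "B ^ 3 = 1" by (simp add: B_def power_mult_distrib \<eta> r(1))
  have du: "(u has_field_derivative deriv u z) (at z)" and dv: "(v has_field_derivative deriv v z) (at z)" for z
    using holomorphic_derivI[OF u(1) open_UNIV, of z] holomorphic_derivI[OF v(1) open_UNIV, of z] by auto
  have "\<forall>\<^sub>\<approx>z\<in>UNIV. deriv u z = B * deriv v z"
    using cosparse_eventually_nhds[OF eq] r(2) cu[OF regular_points] cv[OF regular_points] cv[OF fermat_y_nonzero]
  proof eventually_elim
    case (elim z)
    have yu: "fermat_y (u z) = r * fermat_y (v z)" using elim(2,5) by (simp add: field_simps)
    have 1: "((\<lambda>z. fermat_x (u z)) has_field_derivative s * fermat_y (u z) ^ 2 * deriv u z) (at z)"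
      using DERIV_chain2[OF fermat_x_deriv du] elim(3) unfolding s_def by blast
    have 2: "((\<lambda>z. \<eta> * fermat_x (v z)) has_field_derivative \<eta> * (s * fermat_y (v z) ^ 2 * deriv v z)) (at z)"
      using DERIV_cmult[OF DERIV_chain2[OF fermat_x_deriv dv]] elim(4) unfolding s_def by blast
    have "deriv (\<lambda>z. fermat_x (u z)) z = deriv (\<lambda>z. \<eta> * fermat_x (v z)) z"
      using elim(1) by (intro deriv_cong_ev) auto
    then have "s * fermat_y (u z) ^ 2 * deriv u z = \<eta> * (s * fermat_y (v z) ^ 2 * deriv v z)"
      using DERIV_imp_deriv[OF 1] DERIV_imp_deriv[OF 2] by simp
    then have "(s * fermat_y (v z) ^ 2) * (r ^ 2 * deriv u z) = (s * fermat_y (v z) ^ 2) * (\<eta> * deriv v z)"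
      by (simp add: yu power_mult_distrib mult_ac)
    then have "r ^ 2 * deriv u z = \<eta> * deriv v z" using s0 elim(5) by simp
    then have "r * (r ^ 2 * deriv u z) = r * (\<eta> * deriv v z)" by simp
    also have "r * (r ^ 2 * deriv u z) = r ^ 3 * deriv u z" by (simp add: power2_eq_square power3_eq_cube)
    also have "\<dots> = deriv u z" by (simp add: r(1))
    finally show ?case by (simp add: B_def mult_ac)
  qed
  then have d: "deriv u z = B * deriv v z" for z
    using u(1) v(1) by (intro entire_eq_if_cosparse_eq[of "deriv u" "\<lambda>z. B * deriv v z"] holomorphic_intros) auto
  have "((\<lambda>z. u z - B * v z) has_field_derivative 0) (at z within UNIV)" for z
    using DERIV_diff[OF du[of z] DERIV_cmult[OF dv[of z], of B]] d by simp
  then have "\<exists>c. \<forall>z\<in>UNIV. u z - B * v z = c" by (intro has_field_derivative_zero_constant) auto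
  then obtain c where c: "\<And>z. u z - B * v z = c" by blast
  have uc: "u z = B * v z + c" for z using c[of z] by (simp add: algebra_simps)
  have "\<forall>\<^sub>\<approx>w\<in>UNIV. fermat_x (B * w + c) = \<eta> * fermat_x w"
  proof (rule mero_eq_if_compose_eq[OF _ _ v])
    show "(\<lambda>w. fermat_x (B * w + c)) meromorphic_on UNIV"
      by (intro mero_compose_entire[OF fermat_x_meromorphic] holomorphic_intros)
    show "(\<lambda>w. \<eta> * fermat_x w) meromorphic_on UNIV"
      by (intro meromorphic_intros fermat_x_meromorphic)
    show "\<forall>\<^sub>\<approx>z\<in>UNIV. fermat_x (B * v z + c) = \<eta> * fermat_x (v z)" using eq by (simp add: uc)
  qed
  from fermat_x_self_map[OF this B3 \<eta>] that[OF B3 uc] show ?thesis by blast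
qed

section \<open>The functional equation\<close>

theorem fermat_functional_equation:
  assumes L: "L holomorphic_on UNIV" "\<not> L constant_on UNIV"
    and f: "f meromorphic_on UNIV" "\<not> (\<exists>c. mero_eq f (\<lambda>_. c))"
    and eq: "mero_eq (\<lambda>z. f z ^ 3 + f (L z) ^ 3) (\<lambda>_. 1)"
  obtains q c h A t where "norm q = 1" "\<And>z. L z = q * z + c"
    "h holomorphic_on UNIV" "\<not> h constant_on UNIV" "mero_eq f (\<lambda>z. fermat_x (h z))"
    "A ^ 3 = - 1" "\<And>\<tau>. \<tau> \<in> \<Lambda> \<Longrightarrow> A * \<tau> \<in> \<Lambda>" "t \<in> \<Lambda> \<or> t - \<theta>\<^sub>1 \<in> \<Lambda> \<or> t - \<theta>\<^sub>2 \<in> \<Lambda>"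
    "\<And>z. h (L z) = A * h z + t"
proof -
  have g: "(\<lambda>z. f (L z)) meromorphic_on UNIV" by (rule mero_compose_entire[OF f(1) L(1)])
  have eq': "\<forall>\<^sub>\<approx>z\<in>UNIV. f z ^ 3 + f (L z) ^ 3 = 1" using eq by (simp add: mero_eq_def)
  obtain h \<eta> where h: "h holomorphic_on UNIV" "\<not> h constant_on UNIV" and \<eta>: "\<eta> ^ 3 = 1"
    and fh: "mero_eq f (\<lambda>z. fermat_x (h z))" and gh: "mero_eq (\<lambda>z. f (L z)) (\<lambda>z. \<eta> * fermat_y (h z))"
    using fermat_lift[OF f g eq'] .
  have fL: "\<forall>\<^sub>\<approx>z\<in>UNIV. f (L z) = fermat_x (h (L z))"
    using cosparse_compose_entire[OF L fh[unfolded mero_eq_def]] .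
  have hL: "(\<lambda>z. h (L z)) holomorphic_on UNIV"
    using holomorphic_on_compose_gen[OF L(1) h(1)] by (simp add: o_def)
  have hLn: "\<not> (\<lambda>z. h (L z)) constant_on UNIV"
  proof
    assume "(\<lambda>z. h (L z)) constant_on UNIV"
    then obtain c where c: "\<And>z. h (L z) = c" by (auto simp: constant_on_def)
    have "\<forall>\<^sub>\<approx>w\<in>UNIV. f w = fermat_x c"
      by (rule mero_eq_if_compose_eq[OF f(1) meromorphic_on_const L]) (use fL c in simp)
    then show False using f(2) by (auto simp: mero_eq_def)
  qed
  have nh: "(\<lambda>z. - h z) holomorphic_on UNIV" "\<not> (\<lambda>z. - h z) constant_on UNIV"
  proof -
    show "\<not> (\<lambda>z. - h z) constant_on UNIV"
      using h(2) unfolding constant_on_def by (metis minus_minus)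
  qed (intro holomorphic_intros h)
  (* Two expressions for f (L z): the lift evaluated at L z, and the second Fermat coordinate. *)
  have "\<forall>\<^sub>\<approx>z\<in>UNIV. fermat_x (h (L z)) = \<eta> * fermat_x (- h z)"
    using fL gh[unfolded mero_eq_def] cosparse_compose_entire[OF h off_lattice]
    by eventually_elim (simp add: fermat_x_uminus)
  then obtain B t where
    B: "B ^ 3 = 1" "\<And>z. h (L z) = B * (- h z) + t" and t: "t \<in> \<Lambda> \<or> t - \<theta>\<^sub>1 \<in> \<Lambda> \<or> t - \<theta>\<^sub>2 \<in> \<Lambda>"
    using fermat_x_semiconj[OF hL hLn nh \<eta>] by metis
  have A3: "(- B) ^ 3 = - 1" using B(1) by simp
  have hA: "h (L z) = - B * h z + t" for z using B(2)[of z] by simp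
  have "norm B ^ 3 = 1" using B(1) by (metis norm_one norm_power)
  then have "norm (- B) = 1" using power_eq_imp_eq_base[of "norm B" 3 1] by simp
  then obtain q c where qc: "norm q = 1" "\<And>z. L z = q * z + c"
    using semiconjugate_to_isometry_imp_linear[OF h L, of "- B" t] hA by blast
  have "- B * \<tau> \<in> \<Lambda>" if "\<tau> \<in> \<Lambda>" for \<tau> using lattice_rotate[OF B(1) that] by simp
  then show ?thesis by (rule that[OF qc h fh A3 _ t hA])
qed

theorem fermat_functional_equation_converse:
  assumes L: "L holomorphic_on UNIV" "\<not> L constant_on UNIV"
    and h: "h holomorphic_on UNIV" "\<not> h constant_on UNIV" and fh: "mero_eq f (\<lambda>z. fermat_x (h z))"
    and A: "A ^ 3 = - 1" and t: "t \<in> \<Lambda> \<or> t - \<theta>\<^sub>1 \<in> \<Lambda> \<or> t - \<theta>\<^sub>2 \<in> \<Lambda>"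
    and hL: "\<And>z. h (L z) = A * h z + t"
  shows "mero_eq (\<lambda>z. f z ^ 3 + f (L z) ^ 3) (\<lambda>_. 1)"
  unfolding mero_eq_def
  using fh[unfolded mero_eq_def] cosparse_compose_entire[OF L fh[unfolded mero_eq_def]]
    cosparse_compose_entire[OF h fermat_x_affine[OF A t]]
  by eventually_elim (simp add: hL)

end

text \<open>It remains to translate the three admissible forms of the functional equation for h into a
  single one, whose constant t lies in the class of 0, \<theta>1 or \<theta>2 modulo periods.\<close>

theorem proposition1:
  fixes L f :: "complex \<Rightarrow> complex"
    and \<omega>\<^sub>1 \<omega>\<^sub>2 \<theta>\<^sub>1 \<theta>\<^sub>2 :: complex
  defines "P \<equiv> weierstrass_p \<omega>\<^sub>1 \<omega>\<^sub>2"
    and "\<Lambda> \<equiv> period_lattice \<omega>\<^sub>1 \<omega>\<^sub>2"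
    and "D \<equiv> period_parallelogram \<omega>\<^sub>1 \<omega>\<^sub>2"
  assumes periods: "Im (\<omega>\<^sub>1 / \<omega>\<^sub>2) \<noteq> 0"
    and wp_ode: "\<forall>z. z \<notin> \<Lambda> \<longrightarrow> (deriv P z)\<^sup>2 = 4 * P z ^ 3 - 1"
    and theta1: "\<theta>\<^sub>1 \<in> D - \<Lambda>" "P \<theta>\<^sub>1 = 0" "deriv P \<theta>\<^sub>1 = - \<i>"
    and theta2: "\<theta>\<^sub>2 \<in> D - \<Lambda>" "P \<theta>\<^sub>2 = 0" "deriv P \<theta>\<^sub>2 = \<i>"
    and L_entire: "L holomorphic_on UNIV" and L_nonconst: "\<not> L constant_on UNIV"
    and f_mero: "f meromorphic_on UNIV" and f_nonconst: "\<not> (\<exists>c. mero_eq f (\<lambda>_. c))"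
  shows "mero_eq (\<lambda>z. f z ^ 3 + f (L z) ^ 3) (\<lambda>_. 1) \<longleftrightarrow>
    (\<exists>q c. cmod q = 1 \<and> (\<forall>z. L z = q * z + c)) \<and>
    (\<exists>h. h holomorphic_on UNIV \<and> \<not> h constant_on UNIV \<and>
         mero_eq f (\<lambda>z. (1/2) * (1 + deriv P (h z) / of_real (sqrt 3)) / P (h z)) \<and>
         (\<exists>A. A ^ 3 = -1 \<and> (\<forall>\<tau>\<in>\<Lambda>. A * \<tau> \<in> \<Lambda>) \<and>
              ((\<exists>\<tau>\<^sub>1\<in>\<Lambda>. \<forall>z. h (L z) = A * h z + \<theta>\<^sub>1 + \<tau>\<^sub>1) \<or>
               (\<exists>\<tau>\<^sub>2\<in>\<Lambda>. \<forall>z. h (L z) = A * h z + \<theta>\<^sub>2 + \<tau>\<^sub>2) \<or>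
               (\<exists>\<tau>\<^sub>3\<in>\<Lambda>. \<forall>z. h (L z) = A * h z + \<tau>\<^sub>3))))"
    (is "?eq \<longleftrightarrow> ?lin \<and> (\<exists>h. ?sol h)")
proof -
  interpret equianharmonic \<omega>\<^sub>1 \<omega>\<^sub>2 \<theta>\<^sub>1 \<theta>\<^sub>2
    using periods wp_ode theta1 theta2 unfolding P_def \<Lambda>_def by unfold_locales auto
  have shifts: "((\<exists>\<tau>\<^sub>1\<in>\<Lambda>. \<forall>z. h (L z) = A * h z + \<theta>\<^sub>1 + \<tau>\<^sub>1) \<or>
               (\<exists>\<tau>\<^sub>2\<in>\<Lambda>. \<forall>z. h (L z) = A * h z + \<theta>\<^sub>2 + \<tau>\<^sub>2) \<or>
               (\<exists>\<tau>\<^sub>3\<in>\<Lambda>. \<forall>z. h (L z) = A * h z + \<tau>\<^sub>3)) \<longleftrightarrow>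
      (\<exists>t. (t \<in> \<Lambda> \<or> t - \<theta>\<^sub>1 \<in> \<Lambda> \<or> t - \<theta>\<^sub>2 \<in> \<Lambda>) \<and> (\<forall>z. h (L z) = A * h z + t))" for h A
  proof -
    have "(\<exists>\<tau>\<in>\<Lambda>. \<forall>z. h (L z) = A * h z + \<theta> + \<tau>) \<longleftrightarrow> (\<exists>t. t - \<theta> \<in> \<Lambda> \<and> (\<forall>z. h (L z) = A * h z + t))" for \<theta>
    proof
      assume "\<exists>\<tau>\<in>\<Lambda>. \<forall>z. h (L z) = A * h z + \<theta> + \<tau>"
      then obtain \<tau> where "\<tau> \<in> \<Lambda>" "\<forall>z. h (L z) = A * h z + \<theta> + \<tau>" by blast
      then show "\<exists>t. t - \<theta> \<in> \<Lambda> \<and> (\<forall>z. h (L z) = A * h z + t)"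
        by (intro exI[of _ "\<theta> + \<tau>"]) (auto simp: add.assoc)
    next
      assume "\<exists>t. t - \<theta> \<in> \<Lambda> \<and> (\<forall>z. h (L z) = A * h z + t)"
      then obtain t where "t - \<theta> \<in> \<Lambda>" "\<forall>z. h (L z) = A * h z + t" by blast
      then show "\<exists>\<tau>\<in>\<Lambda>. \<forall>z. h (L z) = A * h z + \<theta> + \<tau>"
        by (intro bexI[of _ "t - \<theta>"]) auto
    qed
    then show ?thesis by blast
  qed
  have form: "(\<lambda>z. (1/2) * (1 + deriv P (h z) / of_real (sqrt 3)) / P (h z)) = (\<lambda>z. fermat_x (h z))" for h
    unfolding fermat_x_def P_def ..
  show ?thesis
    unfolding shifts form
  proof
    assume ?eq
    from fermat_functional_equation[OF L_entire L_nonconst f_mero f_nonconst this]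
    obtain q c h A t where "norm q = 1" "\<And>z. L z = q * z + c"
      "h holomorphic_on UNIV" "\<not> h constant_on UNIV" "mero_eq f (\<lambda>z. fermat_x (h z))"
      "A ^ 3 = - 1" "\<And>\<tau>. \<tau> \<in> \<Lambda> \<Longrightarrow> A * \<tau> \<in> \<Lambda>" "t \<in> \<Lambda> \<or> t - \<theta>\<^sub>1 \<in> \<Lambda> \<or> t - \<theta>\<^sub>2 \<in> \<Lambda>"
      "\<And>z. h (L z) = A * h z + t" unfolding \<Lambda>_def by blast
    then show "(\<exists>q c. cmod q = 1 \<and> (\<forall>z. L z = q * z + c)) \<and>
      (\<exists>h. h holomorphic_on UNIV \<and> \<not> h constant_on UNIV \<and> mero_eq f (\<lambda>z. fermat_x (h z)) \<and>
        (\<exists>A. A ^ 3 = - 1 \<and> (\<forall>\<tau>\<in>\<Lambda>. A * \<tau> \<in> \<Lambda>) \<and>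
          (\<exists>t. (t \<in> \<Lambda> \<or> t - \<theta>\<^sub>1 \<in> \<Lambda> \<or> t - \<theta>\<^sub>2 \<in> \<Lambda>) \<and> (\<forall>z. h (L z) = A * h z + t))))"
      by blast
  next
    assume "(\<exists>q c. cmod q = 1 \<and> (\<forall>z. L z = q * z + c)) \<and>
      (\<exists>h. h holomorphic_on UNIV \<and> \<not> h constant_on UNIV \<and> mero_eq f (\<lambda>z. fermat_x (h z)) \<and>
        (\<exists>A. A ^ 3 = - 1 \<and> (\<forall>\<tau>\<in>\<Lambda>. A * \<tau> \<in> \<Lambda>) \<and>
          (\<exists>t. (t \<in> \<Lambda> \<or> t - \<theta>\<^sub>1 \<in> \<Lambda> \<or> t - \<theta>\<^sub>2 \<in> \<Lambda>) \<and> (\<forall>z. h (L z) = A * h z + t))))"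
    then obtain h A t where *: "h holomorphic_on UNIV" "\<not> h constant_on UNIV" "mero_eq f (\<lambda>z. fermat_x (h z))"
      "A ^ 3 = - 1" "t \<in> \<Lambda> \<or> t - \<theta>\<^sub>1 \<in> \<Lambda> \<or> t - \<theta>\<^sub>2 \<in> \<Lambda>" "\<And>z. h (L z) = A * h z + t" by blast
    show ?eq
      by (rule fermat_functional_equation_converse[OF L_entire L_nonconst *[unfolded \<Lambda>_def]])
  qed
qed

end
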